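(* Let $k,l,m$ be positive integers with $m\geq 3$ and $\frac{2l-1}{2k-1}\leq 1$. Then $\theta(H(m,1,k)^{2l-1})=\frac{2k-1}{2l-1}$.
   Context: For a positive integer $t$, $G^{t}$ has vertex set $V(G)$, with $u,v$ adjacent iff there is a walk of length $t$ between them in $G$. $S_t(G)$ replaces each edge by a path with exactly $t-1$ inner vertices, and for non-negative integers $r,s$, $G^{\frac{2r+1}{2s+1}}:=(S_{2s+1}(G))^{2r+1}$. $og(G)$ is the odd girth. For a non-bipartite graph $G$, the power thickness is $\theta(G):=\sup\{\frac{2r+1}{2s+1}: r,s\ge 0 \text{ integers},\ \chi(G^{\frac{2r+1}{2s+1}})\le\chi(G),\ \frac{2r+1}{2s+1}<og(G)\}$. For positive integers $m,n,k$ with $m\ge 2n$, the helical graph $H(m,n,k)$ has as vertices all $k$-tuples $(A_1,\ldots,A_k)$ of subsets of $\{1,\ldots,m\}$ with $|A_1|=n$, $|A_i|\ge n$ for all $i$, $A_i\cap A_{i+1}=\emptyset$ for $i\le k-1$, and $A_t\subseteq A_{t+2}$ for $t\le k-2$; $(A_1,\ldots,A_k)$ and $(B_1,\ldots,B_k)$ are adjacent iff $A_i\cap B_i=\emptyset$ for all $1\le i\le k$ and $A_j\subseteq B_{j+1}$, $B_j\subseteq A_{j+1}$ for all $1\le j\le k-1$. *)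

theory Defs
  imports "Graph_Theory.Pair_Digraph" "HOL-Library.Extended_Real"
begin

text \<open>Undirected graphs are symmetric digraphs without parallel arcs. Simple graphs are those
  satisfying \<^locale>\<open>pair_graph\<close>; graph powers may have loops.\<close>

definition graph_power :: "'a pair_pre_digraph \<Rightarrow> nat \<Rightarrow> 'a pair_pre_digraph" where
  "graph_power G t =
    \<lparr> pverts = pverts G,
      parcs = {(u, v). \<exists>p. pre_digraph.awalk (with_proj G) u p v \<and> length p = t} \<rparr>"

text \<open>The \<open>i\<close>-th vertex of the path of length \<open>t\<close> that replaces the edge \<open>uv\<close>, counted from \<open>u\<close>.
  An inner vertex is the \<open>i\<close>-th one from \<open>u\<close> and the \<open>(t - i)\<close>-th one from \<open>v\<close>, hence the
  two-element set. This is meant for edges with \<open>u \<noteq> v\<close> only.\<close>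

definition subdiv_vertex :: "nat \<Rightarrow> 'a \<Rightarrow> 'a \<Rightarrow> nat \<Rightarrow> 'a + ('a \<times> 'a \<times> nat) set" where
  "subdiv_vertex t u v i =
    (if i = 0 then Inl u else if i = t then Inl v else Inr {(u, v, i), (v, u, t - i)})"

definition edge_subdivision ::
    "nat \<Rightarrow> 'a pair_pre_digraph \<Rightarrow> ('a + ('a \<times> 'a \<times> nat) set) pair_pre_digraph" where
  "edge_subdivision t G =
    \<lparr> pverts = Inl ` pverts G \<union> {subdiv_vertex t u v i | u v i. (u, v) \<in> parcs G \<and> 0 < i \<and> i < t},
      parcs = {(x, y). \<exists>u v i. (u, v) \<in> parcs G \<and> i < t \<and>
        {x, y} = {subdiv_vertex t u v i, subdiv_vertex t u v (Suc i)}} \<rparr>"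

definition odd_frac_power ::
    "'a pair_pre_digraph \<Rightarrow> nat \<Rightarrow> nat \<Rightarrow> ('a + ('a \<times> 'a \<times> nat) set) pair_pre_digraph" where
  "odd_frac_power G r s = graph_power (edge_subdivision (2 * s + 1) G) (2 * r + 1)"

definition proper_coloring :: "'a pair_pre_digraph \<Rightarrow> nat \<Rightarrow> ('a \<Rightarrow> nat) \<Rightarrow> bool" where
  "proper_coloring G n c \<longleftrightarrow>
    (\<forall>v \<in> pverts G. c v < n) \<and> (\<forall>(u, v) \<in> parcs G. c u \<noteq> c v)"

text \<open>Infinite if there is no proper colouring with finitely many colours, e.g. if there is a
  loop.\<close>

definition chromatic_number :: "'a pair_pre_digraph \<Rightarrow> enat" where
  "chromatic_number G = Inf {enat n | n. \<exists>c. proper_coloring G n c}"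

text \<open>A directed cycle of odd length in a symmetric digraph is an undirected cycle (or a loop);
  the back-and-forth cycles along a single edge have length 2. The odd girth is infinite for
  bipartite graphs.\<close>

definition odd_girth :: "'a pair_pre_digraph \<Rightarrow> enat" where
  "odd_girth G = Inf {enat (length p) | p. pre_digraph.cycle (with_proj G) p \<and> odd (length p)}"

definition power_thickness :: "'a pair_pre_digraph \<Rightarrow> ereal" where
  "power_thickness G =
    Sup {ereal (real (2 * r + 1) / real (2 * s + 1)) | r s.
      chromatic_number (odd_frac_power G r s) \<le> chromatic_number G \<and>
      ereal (real (2 * r + 1) / real (2 * s + 1)) < ereal_of_enat (odd_girth G)}"

text \<open>The tuple \<open>(A\<^sub>1, \<dots>, A\<^sub>k)\<close> is the list with \<open>A\<^sub>i = A ! (i - 1)\<close>.\<close>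

definition helical_graph :: "nat \<Rightarrow> nat \<Rightarrow> nat \<Rightarrow> nat set list pair_pre_digraph" where
  "helical_graph m n k =
    (let V = {A. length A = k \<and> (\<forall>i < k. A ! i \<subseteq> {1..m}) \<and>
          card (A ! 0) = n \<and> (\<forall>i < k. card (A ! i) \<ge> n) \<and>
          (\<forall>i. i + 1 < k \<longrightarrow> A ! i \<inter> A ! (i + 1) = {}) \<and>
          (\<forall>i. i + 2 < k \<longrightarrow> A ! i \<subseteq> A ! (i + 2))}
     in \<lparr> pverts = V,
          parcs = {(A, B). A \<in> V \<and> B \<in> V \<and> (\<forall>i < k. A ! i \<inter> B ! i = {}) \<and>
            (\<forall>j. j + 1 < k \<longrightarrow> A ! j \<subseteq> B ! (j + 1) \<and> B ! j \<subseteq> A ! (j + 1))} \<rparr>)"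

lemma pair_graph_helical_graph:
  assumes "n > 0" "k > 0"
  shows "pair_graph (helical_graph m n k)"
proof -
  let ?G = "helical_graph m n k"
  have fin: "finite (pverts ?G)"
  proof (rule finite_subset)
    show "pverts ?G \<subseteq> {A. set A \<subseteq> Pow {1..m} \<and> length A = k}"
      by (fastforce simp: helical_graph_def Let_def set_conv_nth)
    show "finite {A. set A \<subseteq> Pow {1..m} \<and> length A = k}"
      by (rule finite_lists_length_eq) simp
  qed
  have sub: "parcs ?G \<subseteq> pverts ?G \<times> pverts ?G"
    by (auto simp: helical_graph_def Let_def)
  then have fin': "finite (parcs ?G)"
    using fin by (meson finite_SigmaI finite_subset)
  have irr: "(A, A) \<notin> parcs ?G" for A
    using assms by (auto simp: helical_graph_def Let_def)
  have sy: "sym (parcs ?G)"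
    by (rule symI) (auto simp: helical_graph_def Let_def Int_commute)
  show ?thesis
    by unfold_locales (use fin fin' sub irr sy in \<open>auto simp: symmetric_def\<close>)
qed

lemma subdiv_vertex_sym:
  "i \<le> t \<Longrightarrow> 0 < t \<Longrightarrow> subdiv_vertex t u v i = subdiv_vertex t v u (t - i)"
  by (auto simp: subdiv_vertex_def)

end

theory Submission
  imports Defs "HOL-Library.Z2"
begin

text \<open>Write \<open>K = 2k - 1\<close>, \<open>L = 2l - 1\<close>, \<open>H = H(m,1,k)\<close> and \<open>G = H\<^sup>L\<close>. A graph \<open>X\<close> admits a homomorphism to
  \<open>H\<close> iff \<open>X\<^sup>K\<close> is \<open>m\<close>-colourable; in particular \<open>H\<^sup>K\<close>, and hence \<open>G\<close>, is \<open>m\<close>-colourable.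

  That \<open>G\<close> needs \<open>m\<close> colours is a Borsuk--Ulam phenomenon. It is proved with mod 2 chains
  \<open>h\<^sub>0, \<dots>, h\<^sub>d\<close> of signed simplices satisfying \<open>\<partial>h\<^sub>i\<^sub>+\<^sub>1 = h\<^sub>i + \<tau>h\<^sub>i\<close>, where \<open>\<tau>\<close> flips the signs: in
  every colouring the number of sign-alternating simplices of \<open>h\<^sub>d\<close> is odd, so \<open>d + 1\<close> colours occur.
  A generalised Mycielskian of \<open>H(m,1,k)\<close> with enough levels maps to \<open>H(m+1,1,k)\<close> and extends the
  sequence of chains by one.

  The exponent \<open>K / L\<close> is attained because \<open>S\<^sub>L(H\<^sup>L)\<close> maps to \<open>H\<close>. Conversely, an \<open>m\<close>-colouring of
  \<open>S\<^sub>b(G)\<^sup>a\<close> with \<open>aL > bK\<close> yields, for \<open>Y = S\<^sub>K(S\<^sub>b(G))\<^sup>a\<close>, an \<open>m\<close>-colouring of \<open>Y\<^sup>K\<close>, hence homomorphisms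
  \<open>Y \<rightarrow> H\<close> and \<open>Y\<^sup>L \<rightarrow> G\<close>. But \<open>Y\<^sup>L\<close> is in effect the power \<open>aL / bK > 1\<close> of \<open>G\<close>, and rigidity of the core
  of \<open>G\<close> would force all walks of length 3 in the core to be edges, which is impossible in a
  loopless non-bipartite graph.\<close>

subsection \<open>Walks as relation powers\<close>

lemma relpow_hom:
  assumes "(x, y) \<in> R ^^ n" and "\<And>x y. (x, y) \<in> R \<Longrightarrow> (f x, f y) \<in> S"
  shows "(f x, f y) \<in> S ^^ n"
  using assms(1)
proof (induction n arbitrary: y)
  case (Suc n)
  then show ?case using assms(2) by (auto intro: relpow_Suc_I)
qed simp

lemma sym_relpow: "sym R \<Longrightarrow> sym (R ^^ n)"
proof (induction n)
  case (Suc n)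
  show ?case
  proof (rule symI)
    fix x y assume "(x, y) \<in> R ^^ Suc n"
    then obtain z where "(x, z) \<in> R ^^ n" "(z, y) \<in> R" by auto
    then have "(z, x) \<in> R ^^ n" "(y, z) \<in> R" using Suc by (auto dest: symD)
    then show "(y, x) \<in> R ^^ Suc n" by (rule relpow_Suc_I2[rotated])
  qed
qed (simp add: sym_Id)

lemma relpow_trans: "(x, y) \<in> R ^^ a \<Longrightarrow> (y, z) \<in> R ^^ b \<Longrightarrow> (x, z) \<in> R ^^ (a + b)"
  by (metis relcompI relpow_add)

lemma relpow_mult: "(R ^^ a) ^^ b = R ^^ (a * b)" for R :: "'a rel"
proof (induction b)
  case (Suc b)
  then show ?case by (simp add: relpow_add[symmetric] add.commute)
qed simp

text \<open>The last edge of the walk can be run back and forth, adding two steps each time; a walk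
  of length 0 might offer no edge.\<close>

lemma relpow_pad:
  assumes "sym R" "(x, y) \<in> R ^^ a" "0 < a" "a \<le> b" "even (b - a)"
  shows "(x, y) \<in> R ^^ b"
proof -
  obtain a' where a': "a = Suc a'" using assms(3) gr0_implies_Suc by blast
  then obtain z where "(z, y) \<in> R" using assms(2) by auto
  then have "(y, z) \<in> R" "(z, y) \<in> R" using assms(1) by (auto dest: symD)
  then have yy: "(y, y) \<in> R ^^ 2" by (auto simp: numeral_2_eq_2)
  have "(y, y) \<in> (R ^^ 2) ^^ j" for j
    using yy by (induction j) auto
  then have "(y, y) \<in> R ^^ (b - a)"
    using assms(5) by (metis dvdE relpow_mult)
  then show ?thesis using relpow_trans[OF assms(2)] assms(4) by fastforce
qed

lemma relpow_path:
  assumes "\<And>i. i < n \<Longrightarrow> (p i, p (Suc i)) \<in> R" "a + t \<le> n"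
  shows "(p a, p (a + t)) \<in> R ^^ t"
  using assms(2) by (induction t) (auto intro!: relpow_Suc_I assms(1))

subsection \<open>Chains modulo 2 and an algebraic form of Fan's lemma\<close>

declare add_bit_eq_xor [simp del]

lemma add_self_bit [simp]: "a + a = (0 :: bit)"
  by (cases a) auto

lemma bit_add_eq_0_iff: "a + b = 0 \<longleftrightarrow> a = b" for a b :: bit
  by (cases a; cases b) auto

text \<open>A chain is a list of ordered simplices, read as a formal sum modulo 2. Equalities of chains are
  expressed by evaluating both sides at all cochains.\<close>

fun faces :: "'a list \<Rightarrow> 'a list list" where
  "faces [] = []"
| "faces (x # xs) = xs # map ((#) x) (faces xs)"

definition ev :: "('a list \<Rightarrow> bit) \<Rightarrow> 'a list list \<Rightarrow> bit" where
  "ev \<phi> C = (\<Sum>xs\<leftarrow>C. \<phi> xs)"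

definition bd :: "'a list list \<Rightarrow> 'a list list" where
  "bd C = concat (map faces C)"

lemma ev_simps [simp]:
  "ev \<phi> [] = 0" "ev \<phi> (xs # C) = \<phi> xs + ev \<phi> C" "ev \<phi> (C @ D) = ev \<phi> C + ev \<phi> D"
  "ev \<phi> (map g C') = ev (\<lambda>xs. \<phi> (g xs)) C'"
  by (auto simp: ev_def comp_def)

lemma ev_concat_map: "ev \<phi> (concat (map g C)) = ev (\<lambda>xs. ev \<phi> (g xs)) C"
  by (induction C) auto

lemma ev_bd: "ev \<phi> (bd C) = ev (\<lambda>xs. ev \<phi> (faces xs)) C"
  by (simp add: bd_def ev_concat_map)

lemma ev_add: "ev (\<lambda>xs. \<phi> xs + \<psi> xs) C = ev \<phi> C + ev \<psi> C"
  by (induction C) (auto simp: algebra_simps)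

lemma ev_zero [simp]: "ev (\<lambda>xs. 0) C = 0"
  by (induction C) auto

lemma faces_map: "faces (map f xs) = map (map f) (faces xs)"
  by (induction xs) auto

lemma set_faces: "ys \<in> set (faces xs) \<Longrightarrow> set ys \<subseteq> set xs"
proof (induction xs arbitrary: ys)
  case (Cons x xs)
  then consider "ys = xs" | zs where "zs \<in> set (faces xs)" "ys = x # zs"
    by auto
  then show ?case using Cons.IH by cases auto
qed simp

section \<open>Prisms over simplices\<close>

fun prism :: "('a \<Rightarrow> 'b) \<Rightarrow> ('a \<Rightarrow> 'b) \<Rightarrow> 'a list \<Rightarrow> 'b list list" where
  "prism f g [] = []"
| "prism f g (x # xs) = (f x # g x # map g xs) # map ((#) (f x)) (prism f g xs)"

text \<open>The classical chain homotopy between the maps induced by \<open>f\<close> and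
  \<open>g\<close>: inner walls of the triangulated prism belong to two of its simplices and cancel
  modulo 2.\<close>

lemma prism_homotopy:
  "ev \<phi> (bd (prism f g xs)) + ev (\<lambda>ys. ev \<phi> (prism f g ys)) (faces xs)
     = \<phi> (map f xs) + \<phi> (map g xs)"
proof (induction xs arbitrary: \<phi>)
  case Nil
  then show ?case by (simp add: bd_def)
next
  case (Cons x xs)
  have 1: "ev (\<lambda>ys. ev \<phi> (faces (f x # ys))) (prism f g xs)
     = ev \<phi> (prism f g xs) + ev (\<lambda>ys. \<phi> (f x # ys)) (bd (prism f g xs))"
    by (simp add: ev_bd ev_add)
  have 2: "ev (\<lambda>ys. ev \<phi> (prism f g (x # ys))) (faces xs)
     = ev (\<lambda>ys. \<phi> (f x # g x # map g ys)) (faces xs)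
       + ev (\<lambda>ys. ev (\<lambda>zs. \<phi> (f x # zs)) (prism f g ys)) (faces xs)"
    by (simp add: ev_add)
  have 3: "ev (\<lambda>ys. \<phi> (f x # ys)) (bd (prism f g xs))
      + ev (\<lambda>ys. ev (\<lambda>zs. \<phi> (f x # zs)) (prism f g ys)) (faces xs)
     = \<phi> (f x # map f xs) + \<phi> (f x # map g xs)"
    by (rule Cons.IH)
  have 4: "ev \<phi> (bd (prism f g (x # xs)))
      = \<phi> (g x # map g xs) + \<phi> (f x # map g xs)
        + ev (\<lambda>ys. \<phi> (f x # g x # map g ys)) (faces xs)
        + ev (\<lambda>ys. ev \<phi> (faces (f x # ys))) (prism f g xs)"
    by (simp add: ev_bd faces_map add.assoc)
  have 5: "ev (\<lambda>ys. ev \<phi> (prism f g ys)) (faces (x # xs))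
      = ev \<phi> (prism f g xs) + ev (\<lambda>ys. ev \<phi> (prism f g (x # ys))) (faces xs)"
    by simp
  \<comment> \<open>\<open>X\<close> and \<open>P\<close> occur twice and cancel; the premise on
    \<open>Q + Y\<close> is the induction hypothesis for the cochain that prepends
    \<open>f x\<close>.\<close>
  have 6: "(G + F' + X + (P + Q)) + (P + (X + Y)) = F + G" if "Q + Y = F + F'"
    for F F' G P Q X Y :: bit
  proof -
    have "(G + F' + X + (P + Q)) + (P + (X + Y)) = (X + X) + (P + P) + (G + F' + (Q + Y))"
      by (simp only: ac_simps)
    also have "\<dots> = G + F' + (F + F')" unfolding that by (simp only: add_self_bit add_0)
    also have "\<dots> = F + G + (F' + F')" by (simp only: ac_simps)
    finally show ?thesis by (simp only: add_self_bit add_0_right)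
  qed
  show ?case unfolding 4 5 1 2 list.map by (rule 6[OF 3])
qed

lemma set_prism:
  "ys \<in> set (prism f g xs) \<Longrightarrow> set ys \<subseteq> f ` set xs \<union> g ` set xs"
proof (induction xs arbitrary: ys)
  case (Cons x xs)
  then consider "ys = f x # g x # map g xs" | zs where "zs \<in> set (prism f g xs)" "ys = f x # zs"
    by auto
  then show ?case using Cons.IH by cases auto
qed simp

lemma length_prism: "ys \<in> set (prism f g xs) \<Longrightarrow> length ys = Suc (length xs)"
  by (induction xs arbitrary: ys) auto

text \<open>A simplex of the box complex: the vertices of sign \<open>+\<close> are joined to all vertices of sign \<open>-\<close>,
  and one of the two sides may be empty.\<close>

definition signed_simplex :: "'a rel \<Rightarrow> ('a \<times> bool) list \<Rightarrow> bool" where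
  "signed_simplex R xs \<longleftrightarrow> (\<forall>(u, s) \<in> set xs. \<forall>(v, t) \<in> set xs. s \<noteq> t \<longrightarrow> (u, v) \<in> R)"

abbreviation flip :: "('a \<times> bool) list \<Rightarrow> ('a \<times> bool) list" where
  "flip \<equiv> map (apsnd Not)"

text \<open>A chain-level certificate for a \<open>d\<close>-sphere with antipodal map
  \<open>flip\<close>: \<open>h\<close> is one half of it, bounded by the sphere one dimension
  lower. Since \<open>faces [x] = [[]]\<close>, the base condition says that the number of points is
  odd.\<close>

inductive hemisphere :: "'a rel \<Rightarrow> nat \<Rightarrow> ('a \<times> bool) list list \<Rightarrow> bool" for R where
  zero: "\<lbrakk>\<And>xs. xs \<in> set h \<Longrightarrow> signed_simplex R xs \<and> length xs = 1; \<And>\<phi>. ev \<phi> (bd h) = \<phi> []\<rbrakk>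
    \<Longrightarrow> hemisphere R 0 h"
| Suc: "\<lbrakk>hemisphere R d h; \<And>xs. xs \<in> set h' \<Longrightarrow> signed_simplex R xs \<and> length xs = d + 2;
    \<And>\<phi>. ev \<phi> (bd h') = ev \<phi> h + ev \<phi> (map flip h)\<rbrakk>
    \<Longrightarrow> hemisphere R (Suc d) h'"

lemma hemisphere_simplices:
  "hemisphere R d h \<Longrightarrow> xs \<in> set h \<Longrightarrow> signed_simplex R xs \<and> length xs = Suc d"
  by (induction rule: hemisphere.induct) auto

lemma flip_flip [simp]: "flip (flip xs) = xs"
  by (induction xs) auto

lemma ev_bd_map: "ev \<phi> (bd (map (map f) h)) = ev (\<lambda>xs. \<phi> (map f xs)) (bd h)"
  by (simp add: ev_bd faces_map)

text \<open>The boundary of \<open>h\<close> is the empty simplex or a sum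
  \<open>g + flip g\<close>, hence invariant under \<open>flip\<close>; so the two halves close
  up.\<close>

lemma hemisphere_cycle:
  assumes "hemisphere R d h"
  shows "ev \<phi> (bd h) + ev \<phi> (bd (map flip h)) = 0"
  using assms
proof cases
  case zero
  then show ?thesis by (simp add: ev_bd_map del: ev_simps(4))
next
  case (Suc d h')
  then show ?thesis by (simp add: ev_bd_map add.commute bit_add_eq_0_iff del: map_map)
qed

lemma signed_simplex_hom:
  assumes "signed_simplex R xs" and hom: "\<And>x y. (x, y) \<in> R \<Longrightarrow> (f x, f y) \<in> S"
  shows "signed_simplex S (map (apfst f) xs)"
proof -
  have "(fst p, fst q) \<in> R" if "p \<in> set xs" "q \<in> set xs" "snd p \<noteq> snd q" for p q
    using assms(1) that unfolding signed_simplex_def case_prod_beta by blast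
  then show ?thesis unfolding signed_simplex_def case_prod_beta by (auto intro!: hom)
qed

lemma hemisphere_hom:
  assumes "hemisphere R d h" and hom: "\<And>x y. (x, y) \<in> R \<Longrightarrow> (f x, f y) \<in> S"
  shows "hemisphere S d (map (map (apfst f)) h)"
  using assms(1)
proof (induction rule: hemisphere.induct)
  case (zero h)
  show ?case
  proof (rule hemisphere.zero)
    show "signed_simplex S xs \<and> length xs = 1" if "xs \<in> set (map (map (apfst f)) h)" for xs
      using that zero(1) signed_simplex_hom[where f = f, OF _ hom] by auto
    show "ev \<phi> (bd (map (map (apfst f)) h)) = \<phi> []" for \<phi>
      by (simp add: ev_bd_map zero(2) del: ev_simps(4))
  qed
next
  case (Suc d h h')
  have flip: "flip (map (apfst f) xs) = map (apfst f) (flip xs)" for xs :: "('a \<times> bool) list"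
    by (induction xs) auto
  show ?case
  proof (rule hemisphere.Suc[OF Suc.IH])
    show "signed_simplex S xs \<and> length xs = d + 2" if "xs \<in> set (map (map (apfst f)) h')" for xs
      using that Suc(2) signed_simplex_hom[where f = f, OF _ hom] by auto
    show "ev \<phi> (bd (map (map (apfst f)) h'))
        = ev \<phi> (map (map (apfst f)) h) + ev \<phi> (map flip (map (map (apfst f)) h))" for \<phi>
      by (simp add: ev_bd_map Suc(3) flip del: map_map)
  qed
qed

section \<open>Parity of the sign-alternating simplices\<close>

fun alternating :: "bool \<Rightarrow> bool list \<Rightarrow> bool" where
  "alternating s [] = True"
| "alternating s (t # ts) \<longleftrightarrow> t = s \<and> alternating (\<not> s) ts"

text \<open>An alternating word keeps its first sign when the last letter is dropped and changes it
  when the first is dropped; inner deletions destroy alternation. A non-alternating word has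
  alternating faces only if it has a single repetition, and then it has two equal ones.\<close>

lemma alternating_faces:
  "ev (\<lambda>ts. of_bool (alternating s ts)) (faces ts)
     = of_bool (alternating s ts) + of_bool (alternating (\<not> s) ts)"
proof (induction ts arbitrary: s)
  case (Cons t ts)
  show ?case
  proof (cases "t = s")
    case True
    then show ?thesis using Cons.IH[of "\<not> s"] by simp
  next
    case False
    then show ?thesis by simp
  qed
qed simp

lemma mset_faces_insort:
  assumes "sorted (map f xs)"
  shows "mset (faces (insort_key f x xs)) = add_mset xs (image_mset (insort_key f x) (mset (faces xs)))"
  using assms
proof (induction xs)
  case (Cons y ys)
  show ?case
  proof (cases "f x \<le> f y")
    case True
    have "insort_key f x zs = x # zs" if "zs \<in> set (faces (y # ys))" for zs
    proof (cases zs)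
      case (Cons a list)
      then have "a \<in> set (y # ys)" using set_faces[OF that] by auto
      then show ?thesis using True Cons.prems \<open>sorted (map f (y # ys))\<close> Cons by auto
    qed simp
    then have "image_mset (insort_key f x) (mset (faces (y # ys)))
       = image_mset ((#) x) (mset (faces (y # ys)))"
      by (intro image_mset_cong) (simp only: set_mset_mset)
    then show ?thesis using True by (simp add: multiset.map_comp comp_def)
  next
    case False
    then show ?thesis using Cons by (simp add: multiset.map_comp comp_def)
  qed
qed simp

text \<open>Deleting a vertex commutes with sorting, but the faces are listed in another order;
  hence multisets.\<close>

lemma mset_faces_sort:
  "mset (faces (sort_key f xs)) = image_mset (sort_key f) (mset (faces xs))"
proof (induction xs)
  case (Cons x xs)
  then show ?case by (simp add: mset_faces_insort multiset.map_comp comp_def)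
qed simp

lemma ev_mset: "ev \<phi> C = sum_mset (image_mset \<phi> (mset C))"
  by (induction C) auto

lemma alternating_simplex_odd:
  \<comment> \<open>\<open>\<alpha> s\<close> marks the simplices whose signs, sorted by colour,
    alternate starting with \<open>s\<close>. By \<open>alternating_faces\<close> its value on
    \<open>bd h'\<close> is the total for \<open>h'\<close>; as \<open>flip\<close> exchanges the
    two starts, its value on \<open>h + flip h\<close> is the total for \<open>h\<close>. So the
    parity passes to the next dimension, starting from the empty simplex.\<close>
  fixes col :: "'a \<Rightarrow> nat"
  assumes "hemisphere R d h"
  defines "\<alpha> \<equiv> \<lambda>s (xs :: ('a \<times> bool) list).
    (of_bool (alternating s (map snd (sort_key (col \<circ> fst) xs))) :: bit)"
  shows "ev (\<alpha> True) h + ev (\<alpha> False) h = 1"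
proof -
  have faces: "ev (\<alpha> s) (faces xs) = \<alpha> s xs + \<alpha> (\<not> s) xs" for s xs
  proof -
    have "ev (\<alpha> s) (faces xs)
      = ev (\<lambda>ys. of_bool (alternating s (map snd ys))) (faces (sort_key (col \<circ> fst) xs))"
      by (simp add: ev_mset mset_faces_sort multiset.map_comp comp_def \<alpha>_def)
    also have "\<dots> = ev (\<lambda>ts. of_bool (alternating s ts)) (faces (map snd (sort_key (col \<circ> fst) xs)))"
      by (simp add: faces_map)
    also have "\<dots> = \<alpha> s xs + \<alpha> (\<not> s) xs"
      by (simp add: alternating_faces \<alpha>_def)
    finally show ?thesis .
  qed
  have alt_flip: "alternating s (map Not ts) = alternating (\<not> s) ts" for s ts
    by (induction ts arbitrary: s) auto
  have insort_flip: "insort_key (col \<circ> fst) (apsnd Not x) (flip xs)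
      = flip (insort_key (col \<circ> fst) x xs)" for x and xs :: "('a \<times> bool) list"
    by (induction xs) auto
  have sort_flip: "sort_key (col \<circ> fst) (flip xs) = flip (sort_key (col \<circ> fst) xs)"
    for xs :: "('a \<times> bool) list"
    by (induction xs) (simp_all only: sort_key_simps list.map insort_flip)
  have flip: "\<alpha> s (flip xs) = \<alpha> (\<not> s) xs" for s xs
    using alt_flip[of s "map snd (sort_key (col \<circ> fst) xs)"]
    unfolding \<alpha>_def sort_flip by simp
  have bd: "ev (\<alpha> True) (bd C) = ev (\<alpha> True) C + ev (\<alpha> False) C" for C
    by (simp add: ev_bd faces ev_add)
  show ?thesis using assms(1)
  proof (induction rule: hemisphere.induct)
    case (zero h)
    then show ?case using bd[of h] zero(2)[of "\<alpha> True"] by (simp add: \<alpha>_def)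
  next
    case (Suc d h h')
    then show ?case using bd[of h'] Suc(3)[of "\<alpha> True"] by (simp add: flip)
  qed
qed

lemma alternating_strictly_sorted:
  fixes f :: "'a \<Rightarrow> nat"
  assumes "sorted (map f xs)" "alternating s (map g xs)"
    "\<And>x y. x \<in> set xs \<Longrightarrow> y \<in> set xs \<Longrightarrow> g x \<noteq> g y \<Longrightarrow> f x \<noteq> f y"
  shows "sorted_wrt (<) (map f xs)"
  using assms
proof (induction xs arbitrary: s)
  case (Cons x xs)
  have IH: "sorted_wrt (<) (map f xs)" using Cons by auto
  show ?case
  proof (cases xs)
    case (Cons y ys)
    then have "f x < f y"
      using Cons.prems(1,2) Cons.prems(3)[of x y] by auto
    then show ?thesis using IH Cons by (auto dest: less_trans)
  qed simp
qed simp

text \<open>An odd count is not zero, so some simplex alternates. Neighbours in its colour order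
  have opposite signs, hence are adjacent in \<open>R\<close> and differ in colour, so its
  \<open>d + 1\<close> colours are distinct.\<close>

lemma hemisphere_coloring_lower_bound:
  assumes "hemisphere R d h" "\<And>x y. (x, y) \<in> R \<Longrightarrow> col x \<noteq> col y" "\<And>x. col x < (n :: nat)"
  shows "d < n"
proof -
  have "\<exists>s. ev (\<lambda>xs. of_bool (alternating s (map snd (sort_key (col \<circ> fst) xs)))) h \<noteq> 0"
    using alternating_simplex_odd[OF assms(1), of col] by (metis add_0 zero_neq_one)
  moreover have "\<exists>xs\<in>set C. \<phi> xs \<noteq> 0" if "ev \<phi> C \<noteq> 0" for \<phi> and C :: "('a \<times> bool) list list"
  proof (rule ccontr)
    assume "\<not> ?thesis"
    then have "ev \<phi> C = 0" by (induction C) auto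
    with that show False by simp
  qed
  ultimately obtain s xs where
    "xs \<in> set h" "(of_bool (alternating s (map snd (sort_key (col \<circ> fst) xs))) :: bit) \<noteq> 0"
    by meson
  then have xs: "xs \<in> set h" "alternating s (map snd (sort_key (col \<circ> fst) xs))"
    by (simp_all only: of_bool_eq_0_iff not_not)
  define ys where "ys = sort_key (col \<circ> fst) xs"
  have s: "signed_simplex R xs" "length xs = Suc d"
    using hemisphere_simplices[OF assms(1) xs(1)] by auto
  have "sorted_wrt (<) (map (col \<circ> fst) ys)"
  proof (rule alternating_strictly_sorted[where s = s and g = snd])
    show "sorted (map (col \<circ> fst) ys)" unfolding ys_def by (rule sorted_sort_key)
    show "alternating s (map snd ys)" using xs ys_def by simp
    fix x y assume "x \<in> set ys" "y \<in> set ys" "snd x \<noteq> snd y"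
    then have "(fst x, fst y) \<in> R"
      using s(1) unfolding signed_simplex_def ys_def set_sort case_prod_beta by blast
    then show "(col \<circ> fst) x \<noteq> (col \<circ> fst) y" using assms(2) by simp
  qed
  then have "distinct (map (col \<circ> fst) ys)" by (simp add: strict_sorted_iff)
  then have "card (set (map (col \<circ> fst) ys)) = Suc d"
    using distinct_card[of "map (col \<circ> fst) ys"] s(2) unfolding ys_def by simp
  moreover have "set (map (col \<circ> fst) ys) \<subseteq> {..<n}" using assms(3) by auto
  ultimately show ?thesis
    by (metis Suc_le_eq card_lessThan card_mono finite_lessThan)
qed

subsection \<open>Generalised Mycielskians\<close>

definition level_vertex :: "nat \<Rightarrow> 'a \<Rightarrow> nat \<Rightarrow> ('a \<times> nat) option" where
  "level_vertex q u i = (if i < q then Some (u, i) else None)"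

definition mycielskian :: "nat \<Rightarrow> 'a rel \<Rightarrow> ('a \<times> nat) option rel" where
  "mycielskian q R =
    {(Some (u, 0), Some (v, 0)) | u v. (u, v) \<in> R} \<union>
    {(Some (u, i), Some (v, j)) | u v i j. (u, v) \<in> R \<and> i < q \<and> j < q \<and> (j = Suc i \<or> i = Suc j)} \<union>
    {(Some (u, i), None) | u i. Suc i = q} \<union> {(None, Some (u, i)) | u i. Suc i = q}"

lemma sym_mycielskian: "sym R \<Longrightarrow> sym (mycielskian q R)"
  unfolding mycielskian_def by (rule symI) (auto dest: symD)

text \<open>Level of the vertices of sign \<open>s\<close> after \<open>j\<close> moves: odd moves lift the positive vertices,
  even moves the negative ones, each by two levels except for the first move.\<close>

definition stage :: "nat \<Rightarrow> bool \<Rightarrow> nat" where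
  "stage j s = (if odd j = s then j else j - 1)"

definition stage_map :: "nat \<Rightarrow> nat \<Rightarrow> 'a \<times> bool \<Rightarrow> ('a \<times> nat) option \<times> bool" where
  "stage_map q j = (\<lambda>(u, s). (level_vertex q u (stage j s), s))"

lemma level_vertex_adjacent:
  assumes "(u, v) \<in> R" "a \<le> q" "b \<le> q" "0 < q" "a = Suc b \<or> b = Suc a \<or> (a = 0 \<and> b = 0)"
  shows "(level_vertex q u a, level_vertex q v b) \<in> mycielskian q R"
  using assms by (auto simp: level_vertex_def mycielskian_def)

text \<open>During the move from stage \<open>j\<close> to \<open>Suc j\<close> one sign stays on
  level \<open>j\<close> while the other passes from \<open>j - 1\<close> to \<open>Suc j\<close>.
  So the mixed positions in a prism still lie on neighbouring levels, or both on level 0.\<close>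

lemma stage_adjacent:
  assumes "a = j \<or> a = Suc j" "b = j \<or> b = Suc j" "s \<noteq> t"
  shows "stage a s = Suc (stage b t) \<or> stage b t = Suc (stage a s) \<or> (stage a s = 0 \<and> stage b t = 0)"
  using assms unfolding stage_def by (cases j) auto

lemma signed_simplexD:
  "signed_simplex R xs \<Longrightarrow> (u, s) \<in> set xs \<Longrightarrow> (v, t) \<in> set xs \<Longrightarrow> s \<noteq> t \<Longrightarrow> (u, v) \<in> R"
  unfolding signed_simplex_def by fast

lemma signed_simplexI:
  "(\<And>u v s t. (u, s) \<in> set xs \<Longrightarrow> (v, t) \<in> set xs \<Longrightarrow> s \<noteq> t \<Longrightarrow> (u, v) \<in> R) \<Longrightarrow> signed_simplex R xs"
  unfolding signed_simplex_def by fast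

lemma prism_stage_simplex:
  assumes "signed_simplex R xs" "j < q" "ys \<in> set (prism (stage_map q j) (stage_map q (Suc j)) xs)"
  shows "signed_simplex (mycielskian q R) ys"
proof (rule signed_simplexI)
  have mem: "\<exists>a x. (x, s) \<in> set xs \<and> (a = j \<or> a = Suc j) \<and> u = level_vertex q x (stage a s)"
    if "(u, s) \<in> set ys" for u s
  proof -
    have "(u, s) \<in> stage_map q j ` set xs \<union> stage_map q (Suc j) ` set xs"
      using that set_prism[OF assms(3)] by (rule subsetD[rotated])
    then show ?thesis by (auto simp: stage_map_def)
  qed
  have le: "stage a s \<le> q" if "a = j \<or> a = Suc j" for a s
    using that assms(2) by (auto simp: stage_def)
  fix u v s t assume "(u, s) \<in> set ys" "(v, t) \<in> set ys" "s \<noteq> t"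
  then obtain a x b y where x: "(x, s) \<in> set xs" "a = j \<or> a = Suc j" "u = level_vertex q x (stage a s)"
    and y: "(y, t) \<in> set xs" "b = j \<or> b = Suc j" "v = level_vertex q y (stage b t)"
    using mem by meson
  show "(u, v) \<in> mycielskian q R"
    unfolding x(3) y(3)
  proof (rule level_vertex_adjacent)
    show "(x, y) \<in> R" by (rule signed_simplexD[OF assms(1) x(1) y(1) \<open>s \<noteq> t\<close>])
    show "stage a s = Suc (stage b t) \<or> stage b t = Suc (stage a s) \<or> stage a s = 0 \<and> stage b t = 0"
      by (rule stage_adjacent[OF x(2) y(2) \<open>s \<noteq> t\<close>])
  qed (use le[OF x(2)] le[OF y(2)] assms(2) in auto)
qed

text \<open>At stage \<open>q\<close> the sign \<open>odd q\<close> has reached the apex and the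
  other sign is on level \<open>q - 1\<close>, all of whose vertices are adjacent to the
  apex.\<close>

lemma apex_simplex:
  assumes "signed_simplex R xs" "0 < q"
  shows "signed_simplex (mycielskian q R) ((None, odd q) # map (stage_map q q) xs)"
proof (rule signed_simplexI)
  let ?ys = "(None, odd q) # map (stage_map q q) xs"
  have mem: "u = None \<and> s = odd q \<or> (\<exists>x. u = Some (x, q - 1)) \<and> s \<noteq> odd q"
    if "(u, s) \<in> set ?ys" for u s
    using that assms(2) by (cases "s = odd q") (auto simp: stage_map_def stage_def level_vertex_def)
  fix u v s t assume u: "(u, s) \<in> set ?ys" and v: "(v, t) \<in> set ?ys" and "s \<noteq> t"
  then consider x where "u = None" "v = Some (x, q - 1)" | x where "u = Some (x, q - 1)" "v = None"
    using mem[OF u] mem[OF v] by blast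
  then show "(u, v) \<in> mycielskian q R"
    using assms(2) by cases (auto simp: mycielskian_def)
qed

text \<open>The sphere formed by a hemisphere and its antipode is pushed up through the levels, moving
  the two signs alternately, until one sign has collapsed to the apex. There it is a cone.\<close>

lemma hemisphere_mycielskian:
  assumes "sym R" "hemisphere R d h" "0 < q"
  shows "\<exists>h'. hemisphere (mycielskian q R) (Suc d) h'"
proof -
  let ?M = "mycielskian q R"
  define S where "S = h @ map flip h"
  define P where "P j = concat (map (prism (stage_map q j) (stage_map q (Suc j))) S)" for j
  define Q where "Q = concat (map P [0..<q])"
  define C where "C = map (map (stage_map q q)) S"
  define h' where "h' = Q @ map ((#) (None, odd q)) C"
  have simplex_S: "signed_simplex R xs \<and> length xs = Suc d" if "xs \<in> set S" for xs
  proof -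
    have "signed_simplex R (flip ys)" if "signed_simplex R ys" for ys
      using that unfolding signed_simplex_def case_prod_beta by auto
    then show ?thesis
      using that hemisphere_simplices[OF assms(2)] unfolding S_def by auto
  qed
  have cycle: "ev \<phi> (bd S) = 0" for \<phi>
    using hemisphere_cycle[OF assms(2), of \<phi>] unfolding S_def by (simp add: bd_def)
  have bd_P: "ev \<phi> (bd (P j)) = ev \<phi> (map (map (stage_map q j)) S) + ev \<phi> (map (map (stage_map q (Suc j))) S)"
    for \<phi> j
  proof -
    let ?p = "prism (stage_map q j :: 'a \<times> bool \<Rightarrow> _) (stage_map q (Suc j))"
    have "ev \<phi> (bd (P j)) = ev (\<lambda>xs. ev \<phi> (bd (?p xs))) S"
      unfolding P_def ev_bd ev_concat_map ..
    \<comment> \<open>The added zero, the prism over \<open>bd S\<close>, completes the left side of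
      \<open>prism_homotopy\<close>.\<close>
    also have "\<dots> = ev (\<lambda>xs. ev \<phi> (bd (?p xs))) S + ev (\<lambda>xs. ev \<phi> (?p xs)) (bd S)"
      by (simp only: cycle add_0_right)
    also have "\<dots> = ev (\<lambda>xs. ev \<phi> (bd (?p xs)) + ev (\<lambda>ys. ev \<phi> (?p ys)) (faces xs)) S"
      unfolding ev_bd[of _ S] ev_add ..
    finally show ?thesis by (simp only: prism_homotopy ev_add ev_simps(4))
  qed
  have bd_Q: "ev \<phi> (bd (concat (map P [0..<n])))
     = ev \<phi> (map (map (stage_map q 0)) S) + ev \<phi> (map (map (stage_map q n)) S)" for \<phi> n
  proof (induction n)
    case 0
    then show ?case by (simp add: bd_def)
  next
    case (Suc n)
    have "bd (concat (map P [0..<Suc n])) = bd (concat (map P [0..<n])) @ bd (P n)"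
      by (simp add: bd_def)
    then have "ev \<phi> (bd (concat (map P [0..<Suc n])))
      = (ev \<phi> (map (map (stage_map q 0)) S) + ev \<phi> (map (map (stage_map q n)) S))
        + (ev \<phi> (map (map (stage_map q n)) S) + ev \<phi> (map (map (stage_map q (Suc n))) S))"
      by (simp only: ev_simps(3) Suc bd_P)
    also have "\<dots> = ev \<phi> (map (map (stage_map q 0)) S) + ev \<phi> (map (map (stage_map q (Suc n))) S)
        + (ev \<phi> (map (map (stage_map q n)) S) + ev \<phi> (map (map (stage_map q n)) S))"
      by (simp only: ac_simps)
    finally show ?case by (simp only: add_self_bit add_0_right)
  qed
  have bd_cone: "ev \<phi> (bd (map ((#) (None, odd q)) C)) = ev \<phi> C" for \<phi>
  proof -
    have "ev (\<lambda>xs. \<phi> ((None, odd q) # xs)) (bd C) = 0"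
      unfolding C_def ev_bd_map by (rule cycle)
    then show ?thesis by (simp add: ev_bd ev_add)
  qed
  \<comment> \<open>The prisms leave the copies of \<open>S\<close> at stages 0 and
    \<open>q\<close>; the cone cancels the latter.\<close>
  have "ev \<phi> (bd h') = ev \<phi> (map (map (stage_map q 0)) S)" for \<phi>
  proof -
    have "ev \<phi> (bd h') = ev \<phi> (bd Q) + ev \<phi> (bd (map ((#) (None, odd q)) C))"
      unfolding h'_def by (simp add: bd_def)
    also have "\<dots> = ev \<phi> (map (map (stage_map q 0)) S) + (ev \<phi> C + ev \<phi> C)"
      unfolding bd_cone unfolding Q_def bd_Q C_def by (simp only: add.assoc)
    finally show ?thesis by (simp only: add_self_bit add_0_right)
  qed
  moreover have "stage_map q 0 = apfst (\<lambda>u :: 'a. Some (u, 0 :: nat))"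
    using assms(3) by (auto simp: stage_map_def stage_def level_vertex_def)
  moreover have "map (apfst (\<lambda>u. Some (u, 0 :: nat))) (flip xs) = flip (map (apfst (\<lambda>u. Some (u, 0))) xs)"
    for xs :: "('a \<times> bool) list" by (induction xs) auto
  ultimately have bd_h': "ev \<phi> (bd h') = ev \<phi> (map (map (apfst (\<lambda>u. Some (u, 0)))) h)
     + ev \<phi> (map flip (map (map (apfst (\<lambda>u. Some (u, 0)))) h))" for \<phi>
    unfolding S_def by (simp del: map_map)
  have "hemisphere ?M d (map (map (apfst (\<lambda>u. Some (u, 0)))) h)"
    by (rule hemisphere_hom[OF assms(2)]) (auto simp: mycielskian_def)
  then have "hemisphere ?M (Suc d) h'"
  proof (rule hemisphere.Suc)
    fix xs assume "xs \<in> set h'"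
    then consider j ys where "j < q" "ys \<in> set S" "xs \<in> set (prism (stage_map q j) (stage_map q (Suc j)) ys)"
      | ys where "ys \<in> set S" "xs = (None, odd q) # map (stage_map q q) ys"
      unfolding h'_def Q_def P_def C_def by auto
    then show "signed_simplex ?M xs \<and> length xs = d + 2"
      using simplex_S prism_stage_simplex apex_simplex[OF _ assms(3)] length_prism by cases fastforce+
  qed (rule bd_h')
  then show ?thesis by blast
qed

section \<open>Walks in the Mycielskian and a colouring of its odd power\<close>

definition level :: "nat \<Rightarrow> ('a \<times> nat) option \<Rightarrow> nat" where
  "level q x = (case x of None \<Rightarrow> q | Some (u, i) \<Rightarrow> i)"

lemma mycielskian_walk_level:
  assumes "(x, y) \<in> mycielskian q R ^^ t"
  shows "level q y \<le> level q x + t \<and> level q x \<le> level q y + t"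
  using assms
proof (induction t arbitrary: y)
  case (Suc t)
  then obtain z where z: "(x, z) \<in> mycielskian q R ^^ t" "(z, y) \<in> mycielskian q R" by auto
  then have "level q y \<le> Suc (level q z) \<and> level q z \<le> Suc (level q y)"
    by (auto simp: mycielskian_def level_def)
  then show ?case using Suc.IH[OF z(1)] by auto
qed simp

text \<open>Edges inside level 0 keep the level, all others change it by one. A walk whose parity
  disagrees with its end levels must descend to level 0, use such an edge and climb again.\<close>

lemma mycielskian_walk_parity:
  assumes "(x, y) \<in> mycielskian q R ^^ t"
  shows "even (t + level q x + level q y) \<or> level q x + level q y + 1 \<le> t"
  using assms
proof (induction t arbitrary: y)
  case (Suc t)
  then obtain z where z: "(x, z) \<in> mycielskian q R ^^ t" "(z, y) \<in> mycielskian q R" by auto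
  then have "level q y = Suc (level q z) \<or> level q z = Suc (level q y) \<or> (level q z = 0 \<and> level q y = 0)"
    by (auto simp: mycielskian_def level_def)
  then show ?case using Suc.IH[OF z(1)] mycielskian_walk_level[OF z(1)] by auto
qed simp

text \<open>A walk that avoids the apex projects to \<open>R\<close>; one that meets it has to climb
  to level \<open>q\<close> and come down again.\<close>

lemma mycielskian_walk_project:
  assumes "(x, y) \<in> mycielskian q R ^^ t" "level q x \<le> q"
  shows "level q y \<le> q \<and> ((\<exists>u i v j. x = Some (u, i) \<and> y = Some (v, j) \<and> (u, v) \<in> R ^^ t) \<or>
    (q - level q x) + (q - level q y) \<le> t)"
  using assms
proof (induction t arbitrary: y)
  case 0
  then show ?case by (cases y) (auto simp: level_def)
next
  case (Suc t)
  then obtain z where z: "(x, z) \<in> mycielskian q R ^^ t" "(z, y) \<in> mycielskian q R" by auto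
  note IH = Suc.IH[OF z(1) Suc.prems(2)]
  have lev: "level q y \<le> q \<and> q - level q y \<le> Suc (q - level q z)"
    using z(2) IH by (auto simp: mycielskian_def level_def)
  from IH consider u i v j where "x = Some (u, i)" "z = Some (v, j)" "(u, v) \<in> R ^^ t"
    | "(q - level q x) + (q - level q z) \<le> t" by blast
  then show ?case
  proof cases
    case 1
    then consider w j' where "y = Some (w, j')" "(v, w) \<in> R" | "y = None"
      using z(2) by (auto simp: mycielskian_def)
    then show ?thesis
    proof cases
      case a: 1
      then show ?thesis using 1 lev by auto
    next
      case b: 2
      then show ?thesis
        using mycielskian_walk_level[OF Suc.prems(1)] by (auto simp: level_def)
    qed
  next
    case 2
    then show ?thesis using lev by auto
  qed
qed

text \<open>The new colour is given to the vertices at even distance from the apex on the levels \<open>\<ge> k\<close>.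
  No odd walk of length less than \<open>2 * k\<close> joins two of them, since it would have to use an edge
  of level 0.\<close>

definition mycielskian_coloring :: "nat \<Rightarrow> nat \<Rightarrow> ('a \<Rightarrow> nat) \<Rightarrow> nat \<Rightarrow> ('a \<times> nat) option \<Rightarrow> nat" where
  "mycielskian_coloring k q c m x =
    (case x of None \<Rightarrow> m | Some (u, i) \<Rightarrow> if k \<le> i \<and> even (q + i) then m else c u)"

lemma mycielskian_coloring_proper:
  assumes "0 < k" "3 * k \<le> q" and proper: "\<And>u v. (u, v) \<in> R ^^ (2 * k - 1) \<Longrightarrow> c u \<noteq> c v"
    and range: "\<And>u. c u < m"
    and walk: "(x, y) \<in> mycielskian q R ^^ (2 * k - 1)"
  shows "mycielskian_coloring k q c m x \<noteq> mycielskian_coloring k q c m y"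
proof
  let ?col = "mycielskian_coloring k q c m"
  have odd: "odd (2 * k - 1)" using assms(1) by simp
  have lev: "level q z \<le> q" if "(z, w) \<in> mycielskian q R" for z w
    using that assms(1,2) by (auto simp: mycielskian_def level_def)
  have top: "?col z = m \<longleftrightarrow> k \<le> level q z \<and> even (q + level q z)" for z
    using range assms(1,2) by (auto simp: mycielskian_coloring_def level_def nat_neq_iff split: option.split)
  have "level q x \<le> q"
  proof -
    have eq: "2 * k - 1 = Suc (2 * k - 2)" using assms(1) by simp
    obtain z where "(x, z) \<in> mycielskian q R"
      using walk unfolding eq by (meson relpow_Suc_E2)
    then show ?thesis using lev by blast
  qed
  note project = mycielskian_walk_project[OF walk this]
  note parity = mycielskian_walk_parity[OF walk]
  assume eq: "?col x = ?col y"
  show False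
  proof (cases "?col x = m")
    case True
    then have "k \<le> level q x" "k \<le> level q y" "even (level q x + level q y)"
      using top[of x] top[of y] eq by auto
    then show False using parity odd by presburger
  next
    case False
    then have nt: "\<not> (k \<le> level q x \<and> even (q + level q x))" "\<not> (k \<le> level q y \<and> even (q + level q y))"
      using top[of x] top[of y] eq by auto
    from project consider u i v j where "x = Some (u, i)" "y = Some (v, j)" "(u, v) \<in> R ^^ (2 * k - 1)"
      | "(q - level q x) + (q - level q y) \<le> 2 * k - 1" by blast
    then show False
    proof cases
      case 1
      then have "c u = c v" using eq nt by (auto simp: mycielskian_coloring_def level_def)
      then show False using proper 1 by blast
    next
      case 2
      \<comment> \<open>As \<open>q\<close> is at least \<open>3 * k\<close>, both ends of so short
        a walk near the apex lie above level \<open>k\<close>. Lacking the new colour, both are at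
        odd distance from the apex, and an odd walk between them would have to visit level
        0.\<close>
      then have "k \<le> level q x" "k \<le> level q y" using assms(1,2) by linarith+
      then show False using parity odd nt by presburger
    qed
  qed
qed

subsection \<open>Helical graphs\<close>

text \<open>The \<open>i\<close>-th set assigned to \<open>x\<close> consists of the colours at the ends of the walks of length \<open>i\<close>
  from \<open>x\<close>.\<close>

lemma helical_hom:
  assumes "sym R" "0 < k" and proper: "\<And>x y. (x, y) \<in> R ^^ (2 * k - 1) \<Longrightarrow> c x \<noteq> c y"
    and range: "\<And>x. c x < m"
  shows "\<exists>F. \<forall>(x, y) \<in> R. (F x, F y) \<in> parcs (helical_graph m 1 k)"
proof -
  define A where "A i x = {Suc (c y) | y. (x, y) \<in> R ^^ i}" for i x
  define F where "F x = map (\<lambda>i. A i x) [0..<k]" for x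
  have nth: "F x ! i = A i x" if "i < k" for i x using that by (simp add: F_def)
  have sub: "A i x \<subseteq> {1..m}" for i x using range by (auto simp: A_def Suc_le_eq)
  \<comment> \<open>A common element would be the colour of both ends of a walk of odd length
    \<open>i + t + j\<close>, which pads to length \<open>2 * k - 1\<close>.\<close>
  have disj: "A i x \<inter> A j z = {}" if xz: "(x, z) \<in> R ^^ t" and odd: "odd (i + t + j)" and le: "i + t + j < 2 * k" for i j t x z
  proof -
    have "c u \<noteq> c v" if u: "(x, u) \<in> R ^^ i" and v: "(z, v) \<in> R ^^ j" for u v
    proof (rule proper)
      have "(u, x) \<in> R ^^ i" using sym_relpow[OF assms(1)] u by (metis symD)
      from relpow_trans[OF relpow_trans[OF this xz] v]
      show "(u, v) \<in> R ^^ (2 * k - 1)"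
        by (rule relpow_pad[OF assms(1)]) (use odd le in \<open>auto elim: oddE\<close>)
    qed
    then show ?thesis by (auto simp: A_def)
  qed
  have step: "A i x \<subseteq> A (Suc i) y" if "(x, y) \<in> R" for i x y
  proof -
    have "(y, x) \<in> R" using that assms(1) by (metis symD)
    then show ?thesis unfolding A_def by (auto simp del: relpow.simps intro: relpow_Suc_I2)
  qed
  have vert: "F x \<in> pverts (helical_graph m 1 k)" if xy: "(x, y) \<in> R" for x y
  proof -
    have yx: "(y, x) \<in> R" using xy assms(1) by (metis symD)
    have A0: "A 0 x = {Suc (c x)}" by (auto simp: A_def)
    have "A i x \<noteq> {}" for i
    proof -
      have "A i x \<noteq> {} \<and> A i y \<noteq> {}"
      proof (induction i)
        case 0 show ?case by (auto simp: A_def)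
      next
        case (Suc i) then show ?case using step[OF xy, of i] step[OF yx, of i] by blast
      qed
      then show ?thesis ..
    qed
    then have "1 \<le> card (A i x)" for i
      by (simp add: Suc_le_eq card_gt_0_iff finite_subset[OF sub])
    moreover have "A i x \<inter> A (i + 1) x = {}" if "i + 1 < k" for i
      using disj[of x x 0 i "Suc i"] that by auto
    moreover have "A i x \<subseteq> A (i + 2) x" for i
      using step[OF xy, of i] step[OF yx, of "Suc i"] by auto
    ultimately show ?thesis
      using sub assms(2) by (simp add: helical_graph_def Let_def nth A0) (simp add: F_def)
  qed
  have "(F x, F y) \<in> parcs (helical_graph m 1 k)" if xy: "(x, y) \<in> R" for x y
  proof -
    have yx: "(y, x) \<in> R" using xy assms(1) by (metis symD)
    have "A i x \<inter> A i y = {}" if "i < k" for i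
      using disj[of x y 1 i i] xy that by auto
    moreover have "A j x \<subseteq> A (Suc j) y \<and> A j y \<subseteq> A (Suc j) x" for j
      using step[OF xy] step[OF yx] by blast
    ultimately show ?thesis
      using vert[OF xy] vert[OF yx] by (auto simp: helical_graph_def Let_def nth)
  qed
  then show ?thesis by blast
qed

text \<open>\<open>mod m\<close> brings the elements of \<open>{1..m}\<close> below
  \<open>m\<close>, and for positive \<open>m\<close> also bounds the unspecified value of
  \<open>THE\<close> on lists that are not vertices.\<close>

definition helical_color :: "nat \<Rightarrow> nat set list \<Rightarrow> nat" where
  "helical_color m A = (THE a. A ! 0 = {a}) mod m"

lemma helical_arcs:
  assumes "(A, B) \<in> parcs (helical_graph m n k)"
  shows "i < k \<Longrightarrow> A ! i \<inter> B ! i = {}" "Suc i < k \<Longrightarrow> A ! i \<subseteq> B ! Suc i"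
    "A \<in> pverts (helical_graph m n k)" "B \<in> pverts (helical_graph m n k)"
  using assms by (auto simp: helical_graph_def Let_def)

lemma sym_helical: "0 < n \<Longrightarrow> 0 < k \<Longrightarrow> sym (parcs (helical_graph m n k))"
  by (rule symI) (auto simp: helical_graph_def Let_def)

text \<open>Cut the walk into \<open>k - 1\<close> steps, one step and \<open>k - 1\<close> steps.
  From either end the first set is carried into the last set of the nearer middle vertex, and the
  last sets of the two adjacent middle vertices are disjoint.\<close>

lemma helical_power_coloring:
  assumes "0 < k" "0 < m" and walk: "(A, B) \<in> parcs (helical_graph m 1 k) ^^ (2 * k - 1)"
  shows "helical_color m A \<noteq> helical_color m B"
proof -
  let ?E = "parcs (helical_graph m 1 k)"
  have up: "A ! 0 \<subseteq> B ! t" if "(A, B) \<in> ?E ^^ t" "t < k" for A B t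
    using that
  proof (induction t arbitrary: B)
    case (Suc t)
    then obtain C where "(A, C) \<in> ?E ^^ t" "(C, B) \<in> ?E" by auto
    then show ?case using Suc.IH[of C] Suc.prems(2) helical_arcs(2)[of C B m 1 k t] by auto
  qed simp
  have eq: "2 * k - 1 = (k - 1) + Suc (k - 1)" using assms(1) by simp
  obtain C where C: "(A, C) \<in> ?E ^^ (k - 1)" "(C, B) \<in> ?E ^^ Suc (k - 1)"
    using walk unfolding eq relpow_add by blast
  obtain D where D: "(C, D) \<in> ?E" "(D, B) \<in> ?E ^^ (k - 1)"
    using C(2) by (meson relpow_Suc_E2)
  have "(B, D) \<in> ?E ^^ (k - 1)" using D(2) sym_relpow[OF sym_helical] assms(1) by (metis symD zero_less_one)
  then have disj: "A ! 0 \<inter> B ! 0 = {}"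
    using up[OF C(1)] up[of B D "k - 1"] helical_arcs(1)[OF D(1), of "k - 1"] assms(1) by auto
  have sing: "\<exists>a. X ! 0 = {a} \<and> 1 \<le> a \<and> a \<le> m" if "X \<in> pverts (helical_graph m 1 k)" for X
  proof -
    have "card (X ! 0) = 1" "X ! 0 \<subseteq> {1..m}"
      using that assms(1) by (auto simp: helical_graph_def Let_def)
    then show ?thesis by (metis atLeastAtMost_iff card_1_singletonE insert_subset)
  qed
  have verts: "A \<in> pverts (helical_graph m 1 k)" "B \<in> pverts (helical_graph m 1 k)"
  proof -
    have eq: "2 * k - 1 = Suc (2 * k - 2)" using assms(1) by simp
    show "A \<in> pverts (helical_graph m 1 k)"
      using walk unfolding eq by (metis helical_arcs(3) relpow_Suc_E2)
    show "B \<in> pverts (helical_graph m 1 k)"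
      using walk unfolding eq by (metis helical_arcs(4) relpow_Suc_E)
  qed
  obtain a where a: "A ! 0 = {a}" "1 \<le> a" "a \<le> m" using sing[OF verts(1)] by blast
  obtain b where b: "B ! 0 = {b}" "1 \<le> b" "b \<le> m" using sing[OF verts(2)] by blast
  have "a \<noteq> b" using disj a b by auto
  then have "a mod m \<noteq> b mod m" using a b
    by (cases "a = m"; cases "b = m") auto
  then show ?thesis using a b by (simp add: helical_color_def)
qed

text \<open>The Mycielskian raises the dimension by one, and its colouring with one new colour gives
  a homomorphism to the next helical graph by \<open>helical_hom\<close>.\<close>

lemma helical_hemisphere:
  assumes "0 < k"
  shows "\<exists>h. hemisphere (parcs (helical_graph (Suc d) 1 k)) d h"
proof (induction d)
  case 0
  \<comment> \<open>A single signed point satisfies the adjacency condition vacuously, so any value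
    may serve.\<close>
  have "hemisphere (parcs (helical_graph (Suc 0) 1 k)) 0 [[(undefined, True)]]"
    by (rule hemisphere.zero) (auto simp: signed_simplex_def bd_def)
  then show ?case by blast
next
  case (Suc d)
  let ?E = "parcs (helical_graph (Suc d) 1 k)" and ?q = "3 * k"
  have sym: "sym ?E" using sym_helical assms by simp
  obtain h where h: "hemisphere (mycielskian ?q ?E) (Suc d) h"
    using Suc hemisphere_mycielskian[OF sym] assms by (metis mult_pos_pos zero_less_numeral)
  let ?c = "mycielskian_coloring k ?q (helical_color (Suc d)) (Suc d)"
  have range: "helical_color (Suc d) A < Suc d" for A
    by (simp add: helical_color_def)
  have "\<exists>F. \<forall>(x, y) \<in> mycielskian ?q ?E. (F x, F y) \<in> parcs (helical_graph (Suc (Suc d)) 1 k)"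
  proof (rule helical_hom[OF sym_mycielskian[OF sym] assms])
    show "?c x \<noteq> ?c y" if "(x, y) \<in> mycielskian ?q ?E ^^ (2 * k - 1)" for x y
      using mycielskian_coloring_proper[OF assms _ _ range that] helical_power_coloring[OF assms] by simp
    show "?c x < Suc (Suc d)" for x
      using range by (auto simp: mycielskian_coloring_def less_Suc_eq split: option.split)
  qed
  then obtain F where F: "\<And>x y. (x, y) \<in> mycielskian ?q ?E \<Longrightarrow> (F x, F y) \<in> parcs (helical_graph (Suc (Suc d)) 1 k)"
    by blast
  from hemisphere_hom[where f = F, OF h F] show ?case by blast
qed

lemma helical_coloring_lower_bound:
  assumes "0 < k" "\<And>x y. (x, y) \<in> parcs (helical_graph m 1 k) \<Longrightarrow> c x \<noteq> c y" "\<And>x. c x < (n :: nat)"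
  shows "m \<le> n"
proof (cases m)
  case (Suc d)
  then obtain h where "hemisphere (parcs (helical_graph m 1 k)) d h"
    using helical_hemisphere[OF assms(1)] by blast
  from hemisphere_coloring_lower_bound[where col = c, OF this assms(2,3)] Suc show ?thesis by simp
qed simp

subsection \<open>Powers and subdivisions\<close>

lemma cas_iff_relpow:
  "(\<exists>p. set p \<subseteq> parcs G \<and> pre_digraph.cas (with_proj G) u p v \<and> length p = n) \<longleftrightarrow> (u, v) \<in> parcs G ^^ n"
proof (induction n arbitrary: u)
  case 0
  then show ?case by (auto simp: pre_digraph.cas.simps)
next
  case (Suc n)
  have "(\<exists>p. set p \<subseteq> parcs G \<and> pre_digraph.cas (with_proj G) u p v \<and> length p = Suc n)
    \<longleftrightarrow> (\<exists>w p. (u, w) \<in> parcs G \<and> set p \<subseteq> parcs G \<and> pre_digraph.cas (with_proj G) w p v \<and> length p = n)"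
    (is "?L \<longleftrightarrow> ?R")
  proof
    assume ?L
    then obtain e p where "set (e # p) \<subseteq> parcs G" "pre_digraph.cas (with_proj G) u (e # p) v" "length p = n"
      by (metis length_Suc_conv)
    then show ?R by (cases e) (auto simp: pre_digraph.cas.simps)
  next
    assume ?R
    then obtain w p where "(u, w) \<in> parcs G" "set p \<subseteq> parcs G"
      "pre_digraph.cas (with_proj G) w p v" "length p = n" by blast
    then show ?L by (intro exI[of _ "(u, w) # p"]) (auto simp: pre_digraph.cas.simps)
  qed
  also have "\<dots> \<longleftrightarrow> (\<exists>w. (u, w) \<in> parcs G \<and> (w, v) \<in> parcs G ^^ n)" using Suc by blast
  also have "\<dots> \<longleftrightarrow> (u, v) \<in> parcs G ^^ Suc n"
    by (meson relpow_Suc_D2 relpow_Suc_I2)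
  finally show ?case .
qed

lemma relpow_subset_Times:
  assumes "R \<subseteq> V \<times> V" "0 < t"
  shows "R ^^ t \<subseteq> V \<times> V"
proof (rule subrelI)
  fix u v assume uv: "(u, v) \<in> R ^^ t"
  obtain n where n: "t = Suc n" using assms(2) gr0_implies_Suc by blast
  obtain w where "(u, w) \<in> R" using uv unfolding n by (meson relpow_Suc_E2)
  moreover obtain w' where "(w', v) \<in> R" using uv unfolding n by (meson relpow_Suc_E)
  ultimately show "(u, v) \<in> V \<times> V" using assms(1) by blast
qed

lemma parcs_graph_power:
  assumes "parcs G \<subseteq> pverts G \<times> pverts G" "0 < t"
  shows "parcs (graph_power G t) = parcs G ^^ t"
  using relpow_subset_Times[OF assms] cas_iff_relpow[of G]
  by (auto simp: graph_power_def pre_digraph.awalk_def)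

section \<open>Walks and maps in edge subdivisions\<close>

lemma parcs_edge_subdivision:
  assumes "sym (parcs G)" "0 < t"
  shows "parcs (edge_subdivision t G) =
    {(subdiv_vertex t u v i, subdiv_vertex t u v (Suc i)) | u v i. (u, v) \<in> parcs G \<and> i < t}"
proof -
  have "\<exists>u' v' i'. subdiv_vertex t u v (Suc i) = subdiv_vertex t u' v' i' \<and>
      subdiv_vertex t u v i = subdiv_vertex t u' v' (Suc i') \<and> (u', v') \<in> parcs G \<and> i' < t"
    if "(u, v) \<in> parcs G" "i < t" for u v i
    using that assms subdiv_vertex_sym[of "Suc i" t u v] subdiv_vertex_sym[of i t u v]
    by (intro exI[of _ v] exI[of _ u] exI[of _ "t - Suc i"]) (auto dest: symD simp: Suc_diff_Suc)
  then show ?thesis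
    unfolding edge_subdivision_def by (auto simp: doubleton_eq_iff)
qed

lemma sym_edge_subdivision: "sym (parcs (edge_subdivision t G))"
  by (rule symI) (auto simp: edge_subdivision_def insert_commute)

lemma edge_subdivision_wf:
  assumes "parcs G \<subseteq> pverts G \<times> pverts G"
  shows "parcs (edge_subdivision t G) \<subseteq> pverts (edge_subdivision t G) \<times> pverts (edge_subdivision t G)"
proof -
  have vert: "subdiv_vertex t u v i \<in> pverts (edge_subdivision t G)" if "(u, v) \<in> parcs G" "i \<le> t" for u v i
  proof (cases "i = 0 \<or> i = t")
    case True
    then show ?thesis using that assms by (auto simp: edge_subdivision_def subdiv_vertex_def)
  next
    case False
    then have "0 < i \<and> i < t" using that by auto
    then show ?thesis unfolding edge_subdivision_def using that by auto
  qed
  show ?thesis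
  proof (rule subrelI)
    fix x y assume "(x, y) \<in> parcs (edge_subdivision t G)"
    then obtain u v i where uv: "(u, v) \<in> parcs G" "i < t"
      and "{x, y} = {subdiv_vertex t u v i, subdiv_vertex t u v (Suc i)}"
      unfolding edge_subdivision_def pair_pre_digraph.simps by blast
    then have "x \<in> {subdiv_vertex t u v i, subdiv_vertex t u v (Suc i)}"
      "y \<in> {subdiv_vertex t u v i, subdiv_vertex t u v (Suc i)}" by blast+
    then show "(x, y) \<in> pverts (edge_subdivision t G) \<times> pverts (edge_subdivision t G)"
      using vert[OF uv(1), of i] vert[OF uv(1), of "Suc i"] uv(2) by auto
  qed
qed

text \<open>An inner vertex has two descriptions, one from each end of its edge; a map given along
  the edges is well defined once it agrees on both and at the ends.\<close>

lemma subdiv_vertex_lift: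
  assumes "\<And>u v. (u, v) \<in> E \<Longrightarrow> f u v 0 = a u \<and> f u v t = a v"
    and "\<And>u v i. (u, v) \<in> E \<Longrightarrow> 0 < i \<Longrightarrow> i < t \<Longrightarrow> f u v i = f v u (t - i)"
  shows "\<exists>F. (\<forall>u. F (Inl u) = a u) \<and> (\<forall>(u, v) \<in> E. \<forall>i \<le> t. F (subdiv_vertex t u v i) = f u v i)"
proof -
  define F where "F x = (case x of Inl u \<Rightarrow> a u | Inr S \<Rightarrow> (SOME z. \<exists>(u, v, i) \<in> S. z = f u v i))" for x
  have "F (subdiv_vertex t u v i) = f u v i" if "(u, v) \<in> E" "i \<le> t" for u v i
  proof (cases "0 < i \<and> i < t")
    case True
    have "(SOME z. \<exists>(u', v', i') \<in> {(u, v, i), (v, u, t - i)}. z = f u' v' i') = f u v i"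
      by (rule some_equality) (use assms(2)[OF that(1)] True in auto)
    then show ?thesis using True by (simp add: F_def subdiv_vertex_def)
  next
    case False
    then show ?thesis using that assms(1)[OF that(1)] by (auto simp: F_def subdiv_vertex_def)
  qed
  moreover have "F (Inl u) = a u" for u by (simp add: F_def)
  ultimately show ?thesis by blast
qed

lemma subdiv_vertex_eqD:
  assumes "subdiv_vertex t u v i = subdiv_vertex t u' v' i'" "i < t" "i' < t"
  shows "i = 0 \<and> i' = 0 \<and> u = u' \<or> 0 < i \<and> 0 < i' \<and> (u = u' \<and> v = v' \<and> i = i' \<or> u = v' \<and> v = u' \<and> i = t - i')"
  using assms by (auto simp: subdiv_vertex_def doubleton_eq_iff split: if_splits)

text \<open>\<open>u\<close> is the last branch vertex on the walk, and \<open>e\<close> counts the edges of \<open>G\<close> traversed up to it.\<close>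

lemma subdivision_walk_decompose:
  assumes "sym (parcs G)" "odd t" "(Inl w, y) \<in> parcs (edge_subdivision t G) ^^ n"
  shows "\<exists>u v i e. y = subdiv_vertex t u v i \<and> i < t \<and> (i = 0 \<or> (u, v) \<in> parcs G) \<and>
    (w, u) \<in> parcs G ^^ e \<and> e * t + i \<le> n \<and> even (e + i + n)"
  using assms(3)
proof (induction n arbitrary: y)
  case 0
  then show ?case
    using assms(2) odd_pos
    by (intro exI[of _ w] exI[of _ w] exI[of _ 0]) (auto simp: subdiv_vertex_def)
next
  case (Suc n)
  have "0 < t" using assms(2) odd_pos by blast
  obtain z where z: "(Inl w, z) \<in> parcs (edge_subdivision t G) ^^ n" "(z, y) \<in> parcs (edge_subdivision t G)"
    using Suc.prems by auto
  obtain u v i e where IH: "z = subdiv_vertex t u v i" "i < t" "i = 0 \<or> (u, v) \<in> parcs G"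
    "(w, u) \<in> parcs G ^^ e" "e * t + i \<le> n" "even (e + i + n)"
    using Suc.IH[OF z(1)] by blast
  obtain u' v' p where p: "(u', v') \<in> parcs G" "p < t" "z = subdiv_vertex t u' v' p" "y = subdiv_vertex t u' v' (Suc p)"
    using z(2) unfolding parcs_edge_subdivision[OF assms(1) \<open>0 < t\<close>] by auto
  consider (fwd) "u = u'" "i = p" | (bwd) "0 < i" "u = v'" "v = u'" "i = t - p"
    using subdiv_vertex_eqD[of t u v i u' v' p] IH(1,2) p(2,3) by auto
  then show ?case
  proof cases
    case fwd
    show ?thesis
    proof (cases "Suc p = t")
      case True
      have "y = subdiv_vertex t v' v' 0" using p True by (simp add: subdiv_vertex_def)
      moreover have "(w, v') \<in> parcs G ^^ Suc e" using IH(4) fwd p(1) by auto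
      moreover have "Suc e * t + 0 \<le> Suc n" using IH(5) fwd True by auto
      \<comment> \<open>Completing an edge replaces the offset \<open>t - 1\<close> by 0 and raises
        \<open>e\<close> by one; the parity survives because \<open>t\<close> is odd.\<close>
      moreover have "even (Suc e + 0 + Suc n)" using IH(6) fwd True assms(2) by auto
      ultimately show ?thesis using \<open>0 < t\<close> by blast
    next
      case False
      then have "Suc p < t" using p by simp
      moreover have "e * t + Suc p \<le> Suc n" "even (e + Suc p + Suc n)" using IH fwd by auto
      ultimately show ?thesis using p IH(4) fwd by blast
    qed
  next
    case bwd
    have "y = subdiv_vertex t u v (i - 1)"
      using subdiv_vertex_sym[of "Suc p" t u' v'] p bwd by auto
    moreover have "i - 1 < t" "e * t + (i - 1) \<le> Suc n" "even (e + (i - 1) + Suc n)" using IH bwd by auto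
    moreover have "(u, v) \<in> parcs G" using IH bwd by auto
    ultimately show ?thesis using IH(4) by blast
  qed
qed

lemma subdivision_path:
  assumes "sym (parcs G)" "(u, v) \<in> parcs G" "i + j \<le> t"
  shows "(subdiv_vertex t u v i, subdiv_vertex t u v (i + j)) \<in> parcs (edge_subdivision t G) ^^ j"
proof (cases "t = 0")
  case False
  then show ?thesis
    using assms by (intro relpow_path[where n = t]) (auto simp: parcs_edge_subdivision)
qed (use assms in simp)

text \<open>Since \<open>t\<close> is odd, exactly one end of each subdivided edge is at even distance from a given
  vertex of it; the homomorphism sends the vertex to that end.\<close>

lemma subdivision_power_hom:
  assumes "sym (parcs G)" "irrefl (parcs G)" "odd t"
  shows "\<exists>f. (\<forall>u. f (Inl u) = u) \<and> (\<forall>(x, y) \<in> parcs (edge_subdivision t G) ^^ t. (f x, f y) \<in> parcs G)"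
proof -
  let ?D = "parcs (edge_subdivision t G)"
  have t: "0 < t" using assms(3) odd_pos by blast
  have "\<exists>f. (\<forall>u. f (Inl u) = u) \<and> (\<forall>(u, v) \<in> parcs G. \<forall>i \<le> t. f (subdiv_vertex t u v i) = (if even i then u else v))"
    by (rule subdiv_vertex_lift) (use assms(3) in auto)
  then obtain f where f0: "\<And>u. f (Inl u) = u"
    and f: "\<And>u v i. (u, v) \<in> parcs G \<Longrightarrow> i \<le> t \<Longrightarrow> f (subdiv_vertex t u v i) = (if even i then u else v)"
    by blast
  have "(f x, f y) \<in> parcs G" if xy: "(x, y) \<in> ?D ^^ t" for x y
  proof -
    obtain x' where "(x, x') \<in> ?D" using xy t by (metis gr0_implies_Suc relpow_Suc_E2)
    then obtain a b p where ab: "(a, b) \<in> parcs G" "p < t" "x = subdiv_vertex t a b p"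
      unfolding parcs_edge_subdivision[OF assms(1) t] by auto
    \<comment> \<open>\<open>x\<close> is read from the end at even distance, so that
      \<open>f x = a\<close>.\<close>
    obtain a b p where x: "(a, b) \<in> parcs G" "p \<le> t" "x = subdiv_vertex t a b p" "even p"
    proof (cases "even p")
      case True
      then show ?thesis using that[of a b p] ab by auto
    next
      case False
      have "(b, a) \<in> parcs G" using ab assms(1) by (metis symD)
      moreover have "x = subdiv_vertex t b a (t - p)" using ab subdiv_vertex_sym[of p t a b] t by auto
      moreover have "even (t - p)" using False assms(3) by auto
      ultimately show ?thesis using that[of b a "t - p"] by auto
    qed
    have "(Inl a, x) \<in> ?D ^^ p"
      using subdivision_path[OF assms(1) x(1), of 0 p t] x by (simp add: subdiv_vertex_def)
    from subdivision_walk_decompose[OF assms(1,3) relpow_trans[OF this xy]]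
    obtain u v i e where d: "y = subdiv_vertex t u v i" "i < t" "i = 0 \<or> (u, v) \<in> parcs G"
      "(a, u) \<in> parcs G ^^ e" "e * t + i \<le> p + t" "even (e + i + (p + t))" by blast
    \<comment> \<open>The walk from \<open>a\<close> has length \<open>p + t < 2 * t\<close>, so
      \<open>e\<close> is at most 1. By parity \<open>f y\<close> is \<open>v\<close> with
      \<open>u = a\<close> if \<open>e = 0\<close>, and the neighbour \<open>u\<close> of
      \<open>a\<close> if \<open>e = 1\<close>.\<close>
    have "p < t" using x(2,4) assms(3) by (metis le_neq_implies_less)
    then have "e * t < 2 * t" using d(5) by linarith
    then have "e < 2" using t by simp
    then consider "e = 0" "odd i" | "e = 1" "even i" using d(6) x(4) assms(3) by (cases e) auto
    then show ?thesis
    proof cases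
      case 1
      then show ?thesis using d x f by auto
    next
      case 2
      then have "f y = u" using d f[of u v i] f0[of u] by (cases "i = 0") (auto simp: subdiv_vertex_def[of _ _ _ 0])
      then show ?thesis using 2 d x f by auto
    qed
  qed
  then show ?thesis using f0 by blast
qed

lemma power_subdivision_hom:
  assumes "sym R" "irrefl (R ^^ t)" "0 < t" "parcs G = R ^^ t"
  shows "\<exists>f. \<forall>(x, y) \<in> parcs (edge_subdivision t G). (f x, f y) \<in> R"
proof -
  have symG: "sym (parcs G)" using sym_relpow[OF assms(1)] assms(4) by simp
  have "\<forall>u v. \<exists>w. (u, v) \<in> parcs G \<longrightarrow> w 0 = u \<and> w t = v \<and> (\<forall>i<t. (w i, w (Suc i)) \<in> R)"
    unfolding assms(4) relpow_fun_conv by blast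
  then obtain w where w: "\<And>u v. (u, v) \<in> parcs G \<Longrightarrow> w u v 0 = u \<and> w u v t = v \<and> (\<forall>i<t. (w u v i, w u v (Suc i)) \<in> R)"
    by metis
  \<comment> \<open>The walks chosen for \<open>(u, v)\<close> and \<open>(v, u)\<close> need not be
    reverses of each other. Only the one for the picked orientation is used, and it is read
    backwards from the other end.\<close>
  define orient where "orient S = (SOME (a, b). {a, b} = S)" for S :: "'a set"
  define W where "W u v i = (if orient {u, v} = (u, v) then w u v i else w v u (t - i))" for u v i
  have orient: "(orient {u, v} = (u, v)) \<noteq> (orient {v, u} = (v, u))" if "(u, v) \<in> parcs G" for u v
  proof -
    have "u \<noteq> v" using that assms(2,4) by (auto simp: irrefl_def)
    moreover have "case orient {u, v} of (a, b) \<Rightarrow> {a, b} = {u, v}"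
      unfolding orient_def by (rule someI[of _ "(u, v)"]) simp
    ultimately show ?thesis by (auto simp: doubleton_eq_iff insert_commute[of v u] split: prod.splits)
  qed
  have rev: "(v, u) \<in> parcs G" if "(u, v) \<in> parcs G" for u v using that symG by (metis symD)
  have "\<exists>F. (\<forall>u. F (Inl u) = u) \<and> (\<forall>(u, v) \<in> parcs G. \<forall>i \<le> t. F (subdiv_vertex t u v i) = W u v i)"
  proof (rule subdiv_vertex_lift)
    fix u v assume uv: "(u, v) \<in> parcs G"
    show "W u v 0 = u \<and> W u v t = v" using w[OF uv] w[OF rev[OF uv]] by (simp add: W_def)
    show "W u v i = W v u (t - i)" if "0 < i" "i < t" for i
      using that orient[OF uv] by (auto simp: W_def)
  qed
  then obtain F where F: "\<And>u v i. (u, v) \<in> parcs G \<Longrightarrow> i \<le> t \<Longrightarrow> F (subdiv_vertex t u v i) = W u v i"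
    by blast
  have "(W u v i, W u v (Suc i)) \<in> R" if "(u, v) \<in> parcs G" "i < t" for u v i
  proof (cases "orient {u, v} = (u, v)")
    case True
    then show ?thesis using w that by (simp add: W_def)
  next
    case False
    have "(w v u (t - Suc i), w v u (Suc (t - Suc i))) \<in> R"
      using w[OF rev[OF that(1)]] that(2) by auto
    then have "(w v u (Suc (t - Suc i)), w v u (t - Suc i)) \<in> R" using assms(1) by (metis symD)
    then show ?thesis using False that(2) by (simp add: W_def Suc_diff_Suc)
  qed
  then have "(F x, F y) \<in> R" if "(x, y) \<in> parcs (edge_subdivision t G)" for x y
    using that F unfolding parcs_edge_subdivision[OF symG assms(3)] by auto
  then show ?thesis by blast
qed

subsection \<open>Homomorphisms from a power to a core\<close>

lemma irrefl_if_cubed_subset: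
  assumes "E ^^ 3 \<subseteq> E" "irrefl E"
  shows "(x, x) \<notin> E ^^ (2 * j + 1)"
proof -
  have "E ^^ (2 * j + 1) \<subseteq> E"
  proof (induction j)
    case (Suc j)
    have "E ^^ (2 * Suc j + 1) = E ^^ (2 * j + 1) O E ^^ 2"
      by (simp add: numeral_2_eq_2 O_assoc)
    also have "\<dots> \<subseteq> E O E ^^ 2" using Suc by blast
    also have "\<dots> = E ^^ 3" by (simp add: numeral_3_eq_3 numeral_2_eq_2 O_assoc)
    finally show ?case using assms(1) by blast
  qed simp
  then show ?thesis using assms(2) by (auto simp: irrefl_def)
qed

text \<open>On the core of \<open>E\<close> the homomorphism may be taken to be the identity. Rigidity of the core then
  propagates it along the paths two steps at a time, and at the far ends one sees that walks of
  length 3 are edges.\<close>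

lemma no_hom_from_larger_power:
  fixes E :: "'a rel" and D :: "'b rel" and P :: "'a \<Rightarrow> 'a \<Rightarrow> nat \<Rightarrow> 'b"
  assumes "finite E" "sym E" "irrefl E" and closed: "(z, z) \<in> E ^^ N" "odd N"
    and "sym D" and start: "\<And>u v. P u v 0 = \<iota> u" and finish: "\<And>u v. P u v n = \<iota> v"
    and path: "\<And>u v i. (u, v) \<in> E \<Longrightarrow> i < n \<Longrightarrow> (P u v i, P u v (Suc i)) \<in> D"
    and "odd n" "odd \<alpha>" "n + 2 \<le> \<alpha>"
  shows "\<not> (\<forall>(x, y) \<in> D ^^ \<alpha>. (F x, F y) \<in> E)"
proof
  assume F: "\<forall>(x, y) \<in> D ^^ \<alpha>. (F x, F y) \<in> E"
  define V where "V = Field E"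
  define hom where "hom g \<longleftrightarrow> (\<forall>(x, y) \<in> E. (g x, g y) \<in> E)" for g
  have finV: "finite V" using assms(1) by (simp add: V_def finite_Field)
  have "hom id" by (simp add: hom_def)
  \<comment> \<open>An endomorphism with smallest image, which carries the core.\<close>
  then obtain g where g: "hom g" and least: "\<And>g'. hom g' \<Longrightarrow> card (g ` V) \<le> card (g' ` V)"
    using ex_has_least_nat[of hom id "\<lambda>g. card (g ` V)"] by blast
  define C where "C = g ` V"
  define EC where "EC = E \<inter> C \<times> C"
  have finC: "finite C" using finV by (simp add: C_def)
  have gE: "(g x, g y) \<in> EC" if "(x, y) \<in> E" for x y
    using that g by (auto simp: hom_def EC_def C_def V_def Field_def)
  have symEC: "(y, x) \<in> EC" if "(x, y) \<in> EC" for x y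
    using that assms(2) by (auto simp: EC_def dest: symD)
  have minimal: "card C \<le> card (f ` C)" if "\<And>x y. (x, y) \<in> EC \<Longrightarrow> (f x, f y) \<in> E" for f
  proof -
    have "hom (f \<circ> g)" using that gE by (auto simp: hom_def)
    from least[OF this] show ?thesis by (simp add: C_def image_comp)
  qed
  \<comment> \<open>Otherwise moving \<open>u\<close> to \<open>x\<close> would map the core onto
    fewer vertices.\<close>
  have fold: "x = u" if "u \<in> C" "x \<in> C" and sub: "\<And>v. (u, v) \<in> EC \<Longrightarrow> (x, v) \<in> E" for u x
  proof (rule ccontr)
    assume "x \<noteq> u"
    define f where "f = id(u := x)"
    have "(f a, f b) \<in> E" if "(a, b) \<in> EC" for a b
    proof -
      have "a \<noteq> b" using that assms(3) by (auto simp: EC_def irrefl_def)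
      then show ?thesis
        using that sub[of a] sub[of b] symEC[OF that] assms(2)
        by (auto simp: f_def EC_def dest: symD)
    qed
    then have "card C \<le> card (f ` C)" by (rule minimal)
    also have "f ` C \<subseteq> C - {u}" using \<open>x \<in> C\<close> \<open>x \<noteq> u\<close> by (auto simp: f_def)
    then have "card (f ` C) \<le> card (C - {u})" using finC by (simp add: card_mono)
    also have "\<dots> < card C" using finC \<open>u \<in> C\<close> by (rule card_Diff1_less)
    finally show False by simp
  qed
  have along: "(P u v (i + j), P u v i) \<in> D ^^ j" "(P u v i, P u v (i + j)) \<in> D ^^ j"
    if "(u, v) \<in> E" "i + j \<le> n" for u v i j
  proof -
    show "(P u v i, P u v (i + j)) \<in> D ^^ j"
      using that path by (intro relpow_path[where n = n]) auto
    then show "(P u v (i + j), P u v i) \<in> D ^^ j" using sym_relpow[OF assms(6)] by (metis symD)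
  qed
  have pad: "(x, y) \<in> D ^^ \<alpha>" if "(x, y) \<in> D ^^ (n + 2)" for x y
    using relpow_pad[OF assms(6) that] assms(10-12) by auto
  have branch: "(\<iota> u, \<iota> v) \<in> D ^^ n" if "(u, v) \<in> E" for u v
    using along(2)[OF that, of 0 n] start finish by simp
  define f where "f u = g (F (\<iota> u))" for u
  have fE: "(f u, f v) \<in> EC" if "(u, v) \<in> E" for u v
  proof -
    have "(\<iota> u, \<iota> v) \<in> D ^^ \<alpha>"
      using relpow_pad[OF assms(6) branch[OF that]] assms(10-12) odd_pos[OF assms(10)] by auto
    then show ?thesis using F gE by (auto simp: f_def)
  qed
  have "card C \<le> card (f ` C)" by (rule minimal) (use fE in \<open>auto simp: EC_def\<close>)
  then have inj: "inj_on f C" using finC by (meson card_image_le eq_card_imp_inj_on le_antisym)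
  have "map_prod f f ` EC = EC"
  proof (rule endo_inj_surj)
    show "finite EC" using assms(1) by (simp add: EC_def)
    show "map_prod f f ` EC \<subseteq> EC" using fE by (auto simp: EC_def)
    show "inj_on (map_prod f f) EC"
      by (rule inj_on_subset[OF map_prod_inj_on[OF inj inj]]) (simp add: EC_def)
  qed
  \<comment> \<open>\<open>f\<close> restricts to an automorphism of the core; its inverse
    normalises \<open>F'\<close> to send \<open>\<iota> u\<close> to \<open>u\<close> for
    \<open>u\<close> in \<open>C\<close>.\<close>
  define h where "h = inv_into C f"
  have hf: "h (f u) = u" if "u \<in> C" for u using inj that by (simp add: h_def)
  have hE: "(h x, h y) \<in> EC" if xy: "(x, y) \<in> EC" for x y
  proof -
    have "(x, y) \<in> map_prod f f ` EC" using xy \<open>map_prod f f ` EC = EC\<close> by simp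
    then obtain u v where "(u, v) \<in> EC" "x = f u" "y = f v" by auto
    then show ?thesis using hf by (auto simp: EC_def)
  qed
  define F' where "F' x = h (g (F x))" for x
  have F': "(F' x, F' y) \<in> EC" if "(x, y) \<in> D ^^ (n + 2)" for x y
    using hE gE F pad[OF that] by (auto simp: F'_def)
  have even: "F' (P u w (2 * j)) = u" if "(u, w) \<in> EC" "2 * j \<le> n" for u w j
    using that
  proof (induction j arbitrary: u w)
    case 0
    then show ?case using hf by (auto simp: F'_def start f_def EC_def)
  next
    case (Suc j)
    have uw: "(u, w) \<in> E" using Suc.prems by (simp add: EC_def)
    \<comment> \<open>Back from position \<open>2 * Suc j\<close> to \<open>u\<close>, then along
      \<open>uv\<close> to the vertex at distance \<open>2 * j\<close> from \<open>v\<close>: this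
      takes exactly \<open>n + 2\<close> steps, and its end is sent to \<open>v\<close> by
      induction.\<close>
    have adj: "(F' (P u w (2 * Suc j)), v) \<in> EC" if uv: "(u, v) \<in> EC" for v
    proof -
      have vu: "(v, u) \<in> EC" using symEC[OF uv] .
      have "(P u w (2 * Suc j), \<iota> u) \<in> D ^^ (2 * Suc j)"
        using along(1)[OF uw, of 0 "2 * Suc j"] Suc.prems(2) start by simp
      moreover have "(\<iota> u, P v u (2 * j)) \<in> D ^^ (n - 2 * j)"
        using along(1)[of v u "2 * j" "n - 2 * j"] vu Suc.prems(2) finish[of v u] by (simp add: EC_def)
      ultimately have "(P u w (2 * Suc j), P v u (2 * j)) \<in> D ^^ (2 * Suc j + (n - 2 * j))"
        by (rule relpow_trans)
      moreover have "2 * Suc j + (n - 2 * j) = n + 2" using Suc.prems(2) by simp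
      ultimately have "(F' (P u w (2 * Suc j)), F' (P v u (2 * j))) \<in> EC" using F' by metis
      then show ?thesis using Suc.IH[OF vu] Suc.prems(2) by simp
    qed
    show ?case
      by (rule fold) (use adj Suc.prems(1) in \<open>auto simp: EC_def\<close>)
  qed
  obtain j where n: "n = Suc (2 * j)" using assms(10) by (auto elim: oddE)
  \<comment> \<open>As \<open>2 * j = n - 1\<close>, \<open>even\<close> applies to the neighbours
    of \<open>\<iota> w\<close> and \<open>\<iota> w'\<close> on the paths from \<open>u\<close> and
    \<open>u'\<close>; a walk of length \<open>n + 2\<close> through the path of \<open>w w'\<close>
    joins them.\<close>
  have cube: "(u, u') \<in> EC" if "(u, w) \<in> EC" "(w, w') \<in> EC" "(w', u') \<in> EC" for u w w' u'
  proof -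
    have "(P u w (2 * j), \<iota> w) \<in> D ^^ 1"
      using along(2)[of u w "2 * j" 1] that(1) finish[of u w] n by (simp add: EC_def)
    moreover have "(\<iota> w, \<iota> w') \<in> D ^^ n" using branch that by (simp add: EC_def)
    moreover have "(\<iota> w', P u' w' (2 * j)) \<in> D ^^ 1"
      using along(1)[of u' w' "2 * j" 1] symEC[OF that(3)] finish[of u' w'] n by (simp add: EC_def)
    ultimately have "(P u w (2 * j), P u' w' (2 * j)) \<in> D ^^ (1 + n + 1)"
      by (meson relpow_trans)
    then have "(F' (P u w (2 * j)), F' (P u' w' (2 * j))) \<in> EC" using F' by simp
    then show ?thesis using even[OF that(1)] even[OF symEC[OF that(3)]] n by simp
  qed
  have "EC ^^ 3 \<subseteq> EC" using cube by (auto simp: numeral_3_eq_3)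
  moreover have "irrefl EC" using assms(3) by (auto simp: irrefl_def EC_def)
  moreover have "(g z, g z) \<in> EC ^^ N" using relpow_hom[where f = g, OF closed(1) gE] .
  ultimately show False using irrefl_if_cubed_subset[of EC "g z"] closed(2) by (metis oddE)
qed

subsection \<open>Chromatic numbers, odd girth and power thickness\<close>

lemma Inf_enat_mem: "S \<noteq> {} \<Longrightarrow> Inf S \<in> S" for S :: "enat set"
  by (simp add: Inf_enat_def) (metis LeastI_ex ex_in_conv)

lemma chromatic_number_le_iff: "chromatic_number G \<le> enat n \<longleftrightarrow> (\<exists>c. proper_coloring G n c)"
proof
  let ?S = "{enat n | n. \<exists>c. proper_coloring G n c}"
  assume le: "chromatic_number G \<le> enat n"
  have "?S \<noteq> {}"
  proof
    assume "?S = {}"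
    then have "chromatic_number G = \<infinity>"
      unfolding chromatic_number_def by (simp only: Inf_empty top_enat_def)
    then show False using le by simp
  qed
  then have "Inf ?S \<in> ?S" by (rule Inf_enat_mem)
  then obtain j c where "chromatic_number G = enat j" "proper_coloring G j c"
    unfolding chromatic_number_def by blast
  then show "\<exists>c. proper_coloring G n c"
    using le by (auto simp: proper_coloring_def intro!: exI[of _ c])
next
  assume "\<exists>c. proper_coloring G n c"
  then show "chromatic_number G \<le> enat n"
    unfolding chromatic_number_def by (intro Inf_lower) blast
qed

lemma proper_coloring_total:
  assumes "parcs G \<subseteq> pverts G \<times> pverts G" "proper_coloring G n c" "n \<le> m" "0 < m"
  shows "\<exists>c. (\<forall>x. c x < m) \<and> (\<forall>(x, y) \<in> parcs G. c x \<noteq> c y)"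
  using assms
  by (intro exI[of _ "\<lambda>x. if x \<in> pverts G then c x else 0"])
    (fastforce simp: proper_coloring_def)

lemma less_odd_girth:
  assumes "\<And>p. pre_digraph.cycle (with_proj G) p \<Longrightarrow> odd (length p) \<Longrightarrow> x < real (length p)"
  shows "ereal x < ereal_of_enat (odd_girth G)"
proof (cases "\<exists>p. pre_digraph.cycle (with_proj G) p \<and> odd (length p)")
  case True
  let ?S = "{enat (length p) | p. pre_digraph.cycle (with_proj G) p \<and> odd (length p)}"
  have "?S \<noteq> {}" using True by blast
  then have "Inf ?S \<in> ?S" by (rule Inf_enat_mem)
  then obtain p where "odd_girth G = enat (length p)" "pre_digraph.cycle (with_proj G) p" "odd (length p)"
    unfolding odd_girth_def by blast
  then show ?thesis using assms by simp
next
  case False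
  then have "odd_girth G = \<infinity>" by (auto simp: odd_girth_def Inf_enat_def)
  then show ?thesis by simp
qed

text \<open>Subdivide a triangle into a cycle of length \<open>3 * ?K\<close>. Its power
  \<open>?K\<close> maps back to the triangle and is 3-colourable, so by \<open>helical_hom\<close>
  the cycle maps to the helical graph.\<close>

lemma helical_odd_closed_walk:
  assumes "0 < k" "3 \<le> m"
  shows "\<exists>z. (z, z) \<in> parcs (helical_graph m 1 k) ^^ (3 * (2 * k - 1))"
proof -
  define T :: "nat pair_pre_digraph" where "T = \<lparr> pverts = {..<3}, parcs = {(i, j). i < 3 \<and> j < 3 \<and> i \<noteq> j} \<rparr>"
  let ?K = "2 * k - 1"
  let ?D = "parcs (edge_subdivision ?K T)"
  have odd: "odd ?K" using assms(1) by simp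
  have sym: "sym (parcs T)" and irr: "irrefl (parcs T)"
    by (auto simp: T_def sym_def irrefl_def)
  obtain f where f: "\<And>x y. (x, y) \<in> ?D ^^ ?K \<Longrightarrow> (f x, f y) \<in> parcs T"
    using subdivision_power_hom[OF sym irr odd] by blast
  have "\<exists>F. \<forall>(x, y) \<in> ?D. (F x, F y) \<in> parcs (helical_graph m 1 k)"
  proof (rule helical_hom[OF sym_edge_subdivision assms(1)])
    show "f x mod 3 \<noteq> f y mod 3" if "(x, y) \<in> ?D ^^ ?K" for x y
      using f[OF that] by (auto simp: T_def)
    show "f x mod 3 < m" for x using assms(2) by (meson less_le_trans mod_less_divisor zero_less_numeral)
  qed
  then obtain F where F: "\<And>x y. (x, y) \<in> ?D \<Longrightarrow> (F x, F y) \<in> parcs (helical_graph m 1 k)" by blast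
  have edge: "(Inl u, Inl v) \<in> ?D ^^ ?K" if "(u, v) \<in> parcs T" for u v
    using subdivision_path[OF sym that, of 0 ?K ?K] assms(1) by (simp add: subdiv_vertex_def)
  have "(Inl 0, Inl 0) \<in> ?D ^^ (?K + ?K + ?K)"
    using relpow_trans[OF relpow_trans[OF edge[of 0 1] edge[of 1 2]] edge[of 2 0]] by (simp add: T_def)
  then have "(Inl 0, Inl 0) \<in> ?D ^^ (3 * ?K)" by (simp add: numeral_3_eq_3 add.assoc)
  from relpow_hom[where f = F, OF this F] show ?thesis by blast
qed

section \<open>Chromatic number of odd powers of helical graphs\<close>

lemma helical_wf: "parcs (helical_graph m n k) \<subseteq> pverts (helical_graph m n k) \<times> pverts (helical_graph m n k)"
  by (auto simp: helical_graph_def Let_def)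

lemma pverts_graph_power [simp]: "pverts (graph_power G t) = pverts G"
  by (simp add: graph_power_def)

lemma graph_power_wf:
  assumes "parcs G \<subseteq> pverts G \<times> pverts G" "0 < t"
  shows "parcs (graph_power G t) \<subseteq> pverts (graph_power G t) \<times> pverts (graph_power G t)"
  using relpow_subset_Times[OF assms] parcs_graph_power[OF assms] by simp

lemma parcs_helical_power:
  "0 < l \<Longrightarrow> parcs (graph_power (helical_graph m n k) (2 * l - 1)) = parcs (helical_graph m n k) ^^ (2 * l - 1)"
  by (rule parcs_graph_power[OF helical_wf]) simp

lemma helical_smaller_power_coloring:
  assumes "0 < l" "l \<le> k" "0 < m" "(A, B) \<in> parcs (helical_graph m 1 k) ^^ (2 * l - 1)"
  shows "helical_color m A \<noteq> helical_color m B"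
proof (rule helical_power_coloring)
  show "(A, B) \<in> parcs (helical_graph m 1 k) ^^ (2 * k - 1)"
    by (rule relpow_pad[OF sym_helical assms(4)]) (use assms in auto)
qed (use assms in auto)

lemma helical_color_less: "0 < m \<Longrightarrow> helical_color m A < m"
  by (simp add: helical_color_def)

lemma chromatic_number_helical_power:
  assumes "0 < l" "l \<le> k" "3 \<le> m"
  shows "chromatic_number (graph_power (helical_graph m 1 k) (2 * l - 1)) = enat m"
proof (rule antisym)
  let ?H = "helical_graph m 1 k"
  let ?G = "graph_power ?H (2 * l - 1)"
  have pos: "0 < k" "0 < m" "0 < 2 * l - 1" using assms by auto
  have "proper_coloring ?G m (helical_color m)"
    using helical_smaller_power_coloring[OF assms(1,2) pos(2)] helical_color_less[OF pos(2)]
    unfolding proper_coloring_def parcs_helical_power[OF assms(1)] by blast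
  then show le: "chromatic_number ?G \<le> enat m" using chromatic_number_le_iff by blast
  obtain n where n: "chromatic_number ?G = enat n" using le by (cases "chromatic_number ?G") auto
  then obtain c0 where "proper_coloring ?G n c0" using chromatic_number_le_iff[of ?G n] by auto
  \<comment> \<open>\<open>max n 1\<close> leaves a colour for arguments outside the vertex
    set.\<close>
  from proper_coloring_total[OF graph_power_wf[OF helical_wf pos(3)] this, of "max n 1"]
  have "\<exists>c. (\<forall>x. c x < max n 1) \<and> (\<forall>(x, y) \<in> parcs ?G. c x \<noteq> c y)" by simp
  then obtain c where c: "\<And>x. c x < max n 1" "\<And>x y. (x, y) \<in> parcs ?G \<Longrightarrow> c x \<noteq> c y"
    by blast
  \<comment> \<open>Edges of \<open>?H\<close> can be repeated an odd number of times, so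
    \<open>?H\<close> is a subgraph of \<open>?G\<close> and its lower bound applies.\<close>
  have "m \<le> max n 1"
  proof (rule helical_coloring_lower_bound[OF pos(1) _ c(1)])
    fix x y assume "(x, y) \<in> parcs ?H"
    then have "(x, y) \<in> parcs ?G"
      unfolding parcs_helical_power[OF assms(1)]
      using relpow_pad[OF sym_helical[of 1 k m], where a = 1 and b = "2 * l - 1", of x y] pos assms(1) by simp
    then show "c x \<noteq> c y" by (rule c(2))
  qed
  then show "enat m \<le> chromatic_number ?G" using n assms(3) by simp
qed

section \<open>Fractional powers: the attained exponent and the upper bound\<close>

lemma helical_frac_power_colorable:
  assumes "0 < l" "l \<le> k" "0 < m"
  shows "chromatic_number (odd_frac_power (graph_power (helical_graph m 1 k) (2 * l - 1)) (k - 1) (l - 1)) \<le> enat m"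
proof -
  let ?H = "helical_graph m 1 k"
  let ?G = "graph_power ?H (2 * l - 1)"
  let ?S = "edge_subdivision (2 * l - 1) ?G"
  have pos: "0 < k" "0 < 2 * l - 1" "0 < 2 * k - 1" using assms by auto
  have eq: "2 * (k - 1) + 1 = 2 * k - 1" "2 * (l - 1) + 1 = 2 * l - 1" using assms by auto
  have irr: "irrefl (parcs ?H ^^ (2 * l - 1))"
    using helical_smaller_power_coloring[OF assms] by (auto simp: irrefl_def)
  have sym: "sym (parcs ?H)" using sym_helical pos by simp
  obtain f where f: "\<And>x y. (x, y) \<in> parcs ?S \<Longrightarrow> (f x, f y) \<in> parcs ?H"
    using power_subdivision_hom[OF sym irr pos(2) parcs_helical_power[OF assms(1)]] by blast
  have arcs: "parcs (graph_power ?S (2 * k - 1)) = parcs ?S ^^ (2 * k - 1)"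
    by (rule parcs_graph_power[OF edge_subdivision_wf[OF graph_power_wf[OF helical_wf pos(2)]] pos(3)])
  have "proper_coloring (graph_power ?S (2 * k - 1)) m (helical_color m \<circ> f)"
    using relpow_hom[where f = f, OF _ f] helical_power_coloring[OF pos(1) assms(3)]
      helical_color_less[OF assms(3)]
    unfolding proper_coloring_def arcs by fastforce
  then show ?thesis unfolding odd_frac_power_def eq using chromatic_number_le_iff by blast
qed

text \<open>Position \<open>i\<close> on the path of length \<open>b * t\<close> that replaces
  \<open>uv\<close> after two subdivisions: segment \<open>i div t\<close>, offset
  \<open>i mod t\<close>.\<close>

definition nested_subdiv_vertex where
  "nested_subdiv_vertex b t u v i = (if i = b * t then Inl (Inl v) else
    subdiv_vertex t (subdiv_vertex b u v (i div t)) (subdiv_vertex b u v (Suc (i div t))) (i mod t))"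

lemma nested_subdiv_vertex_eq:
  assumes "q < b" "j \<le> t" "0 < t"
  shows "nested_subdiv_vertex b t u v (q * t + j)
    = subdiv_vertex t (subdiv_vertex b u v q) (subdiv_vertex b u v (Suc q)) j"
proof (cases "j = t")
  case True
  then have eq: "q * t + j = Suc q * t" by simp
  show ?thesis
  proof (cases "Suc q = b")
    case last: True
    then show ?thesis unfolding eq using True assms(3) by (simp add: nested_subdiv_vertex_def subdiv_vertex_def)
  next
    case False
    then have "Suc q * t \<noteq> b * t" using assms(3) by (metis mult_cancel2 less_irrefl)
    moreover have "Suc q * t div t = Suc q" "Suc q * t mod t = 0"
      using assms(3) by (rule div_mult_self_is_m, simp only: mod_mult_self2_is_0)
    ultimately have "nested_subdiv_vertex b t u v (Suc q * t)
      = subdiv_vertex t (subdiv_vertex b u v (Suc q)) (subdiv_vertex b u v (Suc (Suc q))) 0"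
      unfolding nested_subdiv_vertex_def by (simp only: if_False)
    then show ?thesis unfolding eq using True assms(3) by (simp add: subdiv_vertex_def[of t] add.commute)
  qed
next
  case False
  then have j: "j < t" using assms by simp
  then have "q * t + j < Suc q * t" by simp
  also have "\<dots> \<le> b * t" using assms(1) by (intro mult_le_mono1) simp
  finally have "q * t + j \<noteq> b * t" by simp
  moreover have "(q * t + j) div t = q" "(q * t + j) mod t = j" using j by auto
  ultimately show ?thesis by (simp add: nested_subdiv_vertex_def)
qed

lemma nested_subdivision_path:
  assumes "sym (parcs G)" "0 < t" "(u, v) \<in> parcs G" "i < b * t"
  shows "(nested_subdiv_vertex b t u v i, nested_subdiv_vertex b t u v (Suc i))
    \<in> parcs (edge_subdivision t (edge_subdivision b G))"
proof -
  define q j where "q = i div t" and "j = i mod t"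
  have qj: "i = q * t + j" "j < t" "q < b"
    using assms(2,4) by (auto simp: q_def j_def less_mult_imp_div_less)
  have "(subdiv_vertex b u v q, subdiv_vertex b u v (Suc q)) \<in> parcs (edge_subdivision b G)"
    using assms(3) qj(3) parcs_edge_subdivision[OF assms(1), of b] by auto
  then have "(subdiv_vertex t (subdiv_vertex b u v q) (subdiv_vertex b u v (Suc q)) j,
      subdiv_vertex t (subdiv_vertex b u v q) (subdiv_vertex b u v (Suc q)) (Suc j))
      \<in> parcs (edge_subdivision t (edge_subdivision b G))"
    using qj(2) unfolding parcs_edge_subdivision[OF sym_edge_subdivision assms(2)] by blast
  moreover have "nested_subdiv_vertex b t u v i
      = subdiv_vertex t (subdiv_vertex b u v q) (subdiv_vertex b u v (Suc q)) j"
    unfolding qj(1) by (rule nested_subdiv_vertex_eq) (use qj assms(2) in auto)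
  moreover have "nested_subdiv_vertex b t u v (Suc i)
      = subdiv_vertex t (subdiv_vertex b u v q) (subdiv_vertex b u v (Suc q)) (Suc j)"
    unfolding qj(1) add_Suc_right[symmetric]
    by (rule nested_subdiv_vertex_eq) (use qj assms(2) in auto)
  ultimately show ?thesis by simp
qed

lemma helical_frac_power_bound:
  assumes "0 < l" "l \<le> k" "3 \<le> m"
    and col: "chromatic_number (odd_frac_power (graph_power (helical_graph m 1 k) (2 * l - 1)) r s) \<le> enat m"
  shows "(2 * r + 1) * (2 * l - 1) \<le> (2 * s + 1) * (2 * k - 1)"
proof (rule ccontr)
  let ?H = "helical_graph m 1 k"
  let ?G = "graph_power ?H (2 * l - 1)"
  let ?a = "2 * r + 1" and ?b = "2 * s + 1" and ?K = "2 * k - 1" and ?L = "2 * l - 1"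
  let ?Z = "edge_subdivision ?b ?G"
  let ?D = "parcs (edge_subdivision ?K ?Z)"
  assume less: "\<not> ?a * ?L \<le> ?b * ?K"
  have pos: "0 < k" "0 < m" "0 < ?L" "0 < ?K" using assms by auto
  have odd: "odd ?K" "odd ?L" using assms by auto
  note arcs_G = parcs_helical_power[OF assms(1)]
  have symH: "sym (parcs ?H)" using sym_helical pos by simp
  have symG: "sym (parcs ?G)" unfolding arcs_G by (rule sym_relpow[OF symH])
  have irrG: "irrefl (parcs ?G)"
    using helical_smaller_power_coloring[OF assms(1,2) pos(2)] unfolding arcs_G irrefl_def by blast
  have wfZ: "parcs ?Z \<subseteq> pverts ?Z \<times> pverts ?Z"
    by (rule edge_subdivision_wf[OF graph_power_wf[OF helical_wf pos(3)]])
  have wfZa: "parcs (graph_power ?Z ?a) \<subseteq> pverts (graph_power ?Z ?a) \<times> pverts (graph_power ?Z ?a)"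
    by (rule graph_power_wf[OF wfZ]) simp
  have arcs_Za: "parcs (graph_power ?Z ?a) = parcs ?Z ^^ ?a"
    by (rule parcs_graph_power[OF wfZ]) simp
  obtain c0 where "proper_coloring (graph_power ?Z ?a) m c0"
    using col unfolding chromatic_number_le_iff odd_frac_power_def by blast
  from proper_coloring_total[OF wfZa this order_refl pos(2)]
  obtain c where c: "\<And>x. c x < m" "\<And>x y. (x, y) \<in> parcs ?Z ^^ ?a \<Longrightarrow> c x \<noteq> c y"
    unfolding arcs_Za by blast
  have irrZ: "irrefl (parcs ?Z)"
  proof (rule irreflI)
    fix x show "(x, x) \<notin> parcs ?Z"
    proof
      assume "(x, x) \<in> parcs ?Z"
      then have "(x, x) \<in> parcs ?Z ^^ n" for n by (induction n) auto
      then show False using c(2) by blast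
    qed
  qed
  obtain \<psi> where \<psi>: "\<And>x y. (x, y) \<in> ?D ^^ ?K \<Longrightarrow> (\<psi> x, \<psi> y) \<in> parcs ?Z"
    using subdivision_power_hom[OF sym_edge_subdivision irrZ odd(1)] by blast
  have "\<exists>F. \<forall>(x, y) \<in> ?D ^^ ?a. (F x, F y) \<in> parcs ?H"
  proof (rule helical_hom[OF sym_relpow[OF sym_edge_subdivision] pos(1)])
    \<comment> \<open>\<open>?K\<close> blocks of length \<open>?a\<close> are regrouped into
      \<open>?a\<close> blocks of length \<open>?K\<close>, each of which \<open>\<psi>\<close>
      sends to an arc of \<open>?Z\<close>.\<close>
    show "(c \<circ> \<psi>) x \<noteq> (c \<circ> \<psi>) y" if xy: "(x, y) \<in> (?D ^^ ?a) ^^ ?K" for x y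
    proof -
      have "(x, y) \<in> (?D ^^ ?K) ^^ ?a" using xy unfolding relpow_mult by (simp only: mult.commute)
      then have "(\<psi> x, \<psi> y) \<in> parcs ?Z ^^ ?a" by (rule relpow_hom) (rule \<psi>)
      then show ?thesis using c(2) by simp
    qed
    show "(c \<circ> \<psi>) x < m" for x using c(1) by simp
  qed
  then obtain F where F: "\<And>x y. (x, y) \<in> ?D ^^ ?a \<Longrightarrow> (F x, F y) \<in> parcs ?H" by blast
  have hom: "(F x, F y) \<in> parcs ?G" if "(x, y) \<in> ?D ^^ (?a * ?L)" for x y
    using that unfolding arcs_G relpow_mult[symmetric] by (rule relpow_hom) (rule F)
  obtain z where z: "(z, z) \<in> parcs ?H ^^ (3 * ?K)" using helical_odd_closed_walk[OF pos(1) assms(3)] by blast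
  \<comment> \<open>Padding to a multiple of \<open>?L\<close> turns the walk into an odd closed
    walk of \<open>?G\<close>.\<close>
  have "(z, z) \<in> parcs ?H ^^ (3 * ?K * ?L)"
    by (rule relpow_pad[OF symH z]) (use pos odd in auto)
  then have closed: "(z, z) \<in> parcs ?G ^^ (3 * ?K)"
    unfolding arcs_G relpow_mult by (simp only: mult.commute)
  have "finite (pverts ?H)"
    using pair_graph_helical_graph[of 1 k m] pos
    by (simp add: pair_graph_def pair_digraph_def pair_fin_digraph_def pair_fin_digraph_axioms_def)
  then have fin: "finite (parcs ?G)"
    using graph_power_wf[OF helical_wf pos(3), of m 1 k] by (metis finite_SigmaI finite_subset pverts_graph_power)
  have "\<not> (\<forall>(x, y) \<in> ?D ^^ (?a * ?L). (F x, F y) \<in> parcs ?G)"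
  proof (rule no_hom_from_larger_power[where P = "nested_subdiv_vertex ?b ?K" and n = "?b * ?K"
        and \<iota> = "\<lambda>u. Inl (Inl u)", OF fin symG irrG closed _ sym_edge_subdivision])
    show "nested_subdiv_vertex ?b ?K u v 0 = Inl (Inl u)" for u v :: "nat set list"
      using pos(4) by (simp add: nested_subdiv_vertex_def subdiv_vertex_def)
    show "nested_subdiv_vertex ?b ?K u v (?b * ?K) = Inl (Inl v)" for u v :: "nat set list"
      by (simp add: nested_subdiv_vertex_def)
    show "(nested_subdiv_vertex ?b ?K u v i, nested_subdiv_vertex ?b ?K u v (Suc i)) \<in> ?D"
      if "(u, v) \<in> parcs ?G" "i < ?b * ?K" for u v i
      by (rule nested_subdivision_path[OF symG pos(4) that])
    show "odd (3 * ?K)" "odd (?b * ?K)" "odd (?a * ?L)" using odd by auto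
    \<comment> \<open>Both products are odd, so the strict inequality leaves a gap of at least
      2.\<close>
    then show "?b * ?K + 2 \<le> ?a * ?L" using less by presburger
  qed
  then show False using hom by blast
qed

theorem theorem3p3:
  fixes k l m :: nat
  assumes "k > 0" and "l > 0" and "m > 0" and "m \<ge> 3"
    and "(2 * real l - 1) / (2 * real k - 1) \<le> 1"
  shows "power_thickness (graph_power (helical_graph m 1 k) (2 * l - 1))
    = ereal ((2 * real k - 1) / (2 * real l - 1))"
proof -
  let ?H = "helical_graph m 1 k"
  let ?G = "graph_power ?H (2 * l - 1)"
  have lk: "l \<le> k" using assms(1,5) by (simp add: divide_le_eq_1)
  have pos: "0 < 2 * real l - 1" "0 < 2 * real k - 1" using assms(1,2) by auto
  have real: "real (2 * l - 1) = 2 * real l - 1" "real (2 * k - 1) = 2 * real k - 1"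
    using assms(1,2) by (auto simp: of_nat_diff)
  have frac: "real (2 * (k - 1) + 1) / real (2 * (l - 1) + 1) = (2 * real k - 1) / (2 * real l - 1)"
    using assms(1,2) by (simp add: of_nat_diff algebra_simps)
  note chi = chromatic_number_helical_power[OF assms(2) lk assms(4)]
  have girth: "ereal ((2 * real k - 1) / (2 * real l - 1)) < ereal_of_enat (odd_girth ?G)"
  proof (rule less_odd_girth)
    fix p assume p: "pre_digraph.cycle (with_proj ?G) p" "odd (length p)"
    then obtain u where "pre_digraph.awalk (with_proj ?G) u p u" by (auto simp: pre_digraph.cycle_def)
    then have "(u, u) \<in> parcs ?G ^^ length p"
      using cas_iff_relpow[of ?G u u "length p"] by (auto simp: pre_digraph.awalk_def)
    then have u: "(u, u) \<in> parcs ?H ^^ ((2 * l - 1) * length p)"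
      unfolding parcs_helical_power[OF assms(2)] relpow_mult .
    \<comment> \<open>A shorter odd closed walk of \<open>?H\<close> would pad to length
      \<open>2 * k - 1\<close> and make the colour of \<open>u\<close> differ from itself.\<close>
    have "2 * k - 1 < (2 * l - 1) * length p"
    proof (rule ccontr)
      assume "\<not> ?thesis"
      then have "(u, u) \<in> parcs ?H ^^ (2 * k - 1)"
        by (intro relpow_pad[OF sym_helical u]) (use assms(1,2) p(2) odd_pos in auto)
      then show False using helical_power_coloring[OF assms(1,3)] by blast
    qed
    then have "real (2 * k - 1) < real (2 * l - 1) * real (length p)" by (metis of_nat_less_iff of_nat_mult)
    then show "(2 * real k - 1) / (2 * real l - 1) < real (length p)"
      unfolding real using pos by (simp add: divide_less_eq mult.commute)
  qed
  show ?thesis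
    unfolding power_thickness_def chi
  proof (rule antisym)
    show "Sup {ereal (real (2 * r + 1) / real (2 * s + 1)) | r s.
        chromatic_number (odd_frac_power ?G r s) \<le> enat m \<and>
        ereal (real (2 * r + 1) / real (2 * s + 1)) < ereal_of_enat (odd_girth ?G)}
      \<le> ereal ((2 * real k - 1) / (2 * real l - 1))"
    proof (rule Sup_least, clarify)
      fix r s assume "chromatic_number (odd_frac_power ?G r s) \<le> enat m"
      then have "(2 * r + 1) * (2 * l - 1) \<le> (2 * s + 1) * (2 * k - 1)"
        by (rule helical_frac_power_bound[OF assms(2) lk assms(4)])
      then have "real (2 * r + 1) * real (2 * l - 1) \<le> real (2 * s + 1) * real (2 * k - 1)"
        by (metis of_nat_le_iff of_nat_mult)
      then show "ereal (real (2 * r + 1) / real (2 * s + 1)) \<le> ereal ((2 * real k - 1) / (2 * real l - 1))"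
        unfolding real using pos by (simp add: divide_simps mult.commute)
    qed
    \<comment> \<open>The value is attained at \<open>r = k - 1\<close> and
      \<open>s = l - 1\<close>.\<close>
    show "ereal ((2 * real k - 1) / (2 * real l - 1)) \<le> Sup {ereal (real (2 * r + 1) / real (2 * s + 1)) | r s.
        chromatic_number (odd_frac_power ?G r s) \<le> enat m \<and>
        ereal (real (2 * r + 1) / real (2 * s + 1)) < ereal_of_enat (odd_girth ?G)}"
      using helical_frac_power_colorable[OF assms(2) lk assms(3)] girth
      by (intro Sup_upper) (unfold frac[symmetric], blast)
  qed
qed

end
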